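(* There is no closed $\mathrm T+\mathit{min}$ term $\mathsf{BR}:2\to2\to1$ such that the following hold for all closed $\mathrm T_0^{\mathrm{str}}$ terms $F,G:2$ with $\mathcal T^K(F)$ well-founded, and for all $\vec x\in\mathcal T^K(F)$: $$\mathsf{BR}\;F\,G\,\widehat{\langle\vec x\rangle}=\widehat{2\langle\vec x\rangle+1}\quad\text{if }\vec x\in\mathcal T^K(F)^l,$$ $$\mathsf{BR}\;F\,G\,\widehat{\langle\vec x\rangle}=G\,(\lambda z^{\mathtt N}.\;\mathsf{BR}\;F\,G\,(\mathrm{add}\,\widehat{\langle\vec x\rangle}\,z))\quad\text{if }\vec x\in\mathcal T^K(F)^n.$$ Here $=$ means that the closed programs on the two sides evaluate to the same numeral.
   Context: **Types.** $\sigma,\tau::=\mathtt N\mid\sigma\to\tau$. Pure types: $0=\mathtt N$, $k+1=k\to\mathtt N$. **Languages.** All terms are simply typed $\lambda$-terms over constants. Base constants: $\widehat n:\mathtt N$ ($n\in\mathbb N$), $\mathit{suc},\mathit{pre}:\mathtt N\to\mathtt N$, $\mathit{ifzero}:\mathtt N\to\mathtt N\to\mathtt N\to\mathtt N$. $\mathrm T+\mathit{min}$ adds $\mathit{rec}_\sigma:\sigma\to(\sigma\to\mathtt N\to\sigma)\to\mathtt N\to\sigma$ for every $\sigma$, and $\mathit{min}:(\mathtt N\to\mathtt N)\to\mathtt N\to\mathtt N$. $\mathrm T_0^{\mathrm{str}}$ adds instead to the base constants $\mathit{byval}:(\mathtt N\to\mathtt N)\to\mathtt N\to\mathtt N$ and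 $\mathit{rec}^{\mathrm{str}}:\mathtt N\to(\mathtt N\to\mathtt N\to\mathtt N)\to\mathtt N\to\mathtt N$. Terms mixing the constants of both languages are evaluated by the union of the following (deterministic, call-by-name) rules: $(\lambda x.M)N\rightsquigarrow M[x\mapsto N]$; $\mathit{suc}\,\widehat n\rightsquigarrow\widehat{n+1}$; $\mathit{pre}\,\widehat{n+1}\rightsquigarrow\widehat n$; $\mathit{pre}\,\widehat0\rightsquigarrow\widehat0$; $\mathit{ifzero}\,\widehat0\rightsquigarrow\lambda xy.x$; $\mathit{ifzero}\,\widehat{n+1}\rightsquigarrow\lambda xy.y$; $\mathit{rec}_\sigma XF\widehat0\rightsquigarrow X$; $\mathit{rec}_\sigma XF\widehat{n+1}\rightsquigarrow F(\mathit{rec}_\sigma XF\widehat n)\widehat n$; $\mathit{min}\,F\,\widehat n\rightsquigarrow\mathit{ifzero}(F\widehat n)\,\widehat n\,(\mathit{min}\,F(\mathit{suc}\,\widehat n))$; $\mathit{byval}\,F\,\widehat n\rightsquigarrow F\widehat n$; $\mathit{rec}^{\mathrm{str}}XF\widehat0\rightsquigarrow X$; $\mathit{rec}^{\mathrm{str}}XF\widehat{n+1}\rightsquigarrow\mathit{byval}(\lambda m.Fm\widehat n)(\mathit{rec}^{\mathrm{str}}XF\widehat n)$; and if $M\rightsquigarrow M'$ then $E[M]\rightsquigarrow E[M']$ for $E[-]$ one of $[-]N$, $\mathit{suc}[-]$, $\mathit{pre}[-]$, $\mathit{ifzero}[-]$, $\mathit{rec}_\sigma XF[-]$, $\mathit{min}\,F[-]$,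 $\mathit{byval}\,F[-]$, $\mathit{rec}^{\mathrm{str}}XF[-]$. A closed $M:\mathtt N$ evaluates to $\widehat n$ if $M\rightsquigarrow^*\widehat n$. **Trees.** $\langle\cdots\rangle:\mathbb N^*\to\mathbb N$ is a fixed standard (injective) primitive recursive coding of finite sequences. Fix closed $\mathrm T_0^{\mathrm{str}}$ programs $\mathrm{add}:\mathtt N\to\mathtt N\to\mathtt N$ and $\mathrm{basic}:\mathtt N\to\mathtt N\to\mathtt N\to\mathtt N$ such that $\mathrm{add}\,\widehat{\langle\vec x\rangle}\,\widehat z\rightsquigarrow^*\widehat{\langle\vec x,z\rangle}$ and $\mathrm{basic}\,\widehat{\langle\vec x\rangle}\,\widehat j\,\widehat i$ evaluates to $\widehat{x_i}$ if $i<|\vec x|$ and to $\widehat j$ otherwise. For a closed $\mathrm T_0^{\mathrm{str}}$ term $F:2$, a sequence $\vec x\in\mathbb N^*$ satisfies the Kohlenbach bar condition w.r.t. $F$ if $F(\mathrm{basic}\,\widehat{\langle\vec x\rangle}\,\widehat0)$ and $F(\mathrm{basic}\,\widehat{\langle\vec x\rangle}\,\widehat1)$ evaluate to the same numeral. $\mathcal T^K(F)\subseteq\mathbb N^*$ is the tree of all $\vec x$ such that no proper prefix of $\vec x$ satisfies this condition. It is well-founded if there is no infinite sequence $x_0,x_1,\ldots$ all of whose finite initial segments are in the tree. $\mathcal T^K(F)^l$ is the set of leaves (nodes with no child in the tree), $\mathcal T^K(F)^n$ the set of internal nodes (all of whose children $(\vec x,y)$, $y\in\mathbb N$, are in the tree).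 *)

theory Defs
  imports "HOL-Library.Sublist"
begin

datatype ty = NatT | Arr ty ty  (infixr "\<^bold>\<rightarrow>" 60)

fun pure_ty :: "nat \<Rightarrow> ty" where
  "pure_ty 0 = NatT"
| "pure_ty (Suc k) = pure_ty k \<^bold>\<rightarrow> NatT"

datatype const =
    CNum nat | CSuc | CPre | CIfzero
  | CRec ty | CMin
  | CByval | CRecstr

fun const_ty :: "const \<Rightarrow> ty" where
  "const_ty (CNum n) = NatT"
| "const_ty CSuc = NatT \<^bold>\<rightarrow> NatT"
| "const_ty CPre = NatT \<^bold>\<rightarrow> NatT"
| "const_ty CIfzero = NatT \<^bold>\<rightarrow> NatT \<^bold>\<rightarrow> NatT \<^bold>\<rightarrow> NatT"
| "const_ty (CRec \<sigma>) = \<sigma> \<^bold>\<rightarrow> (\<sigma> \<^bold>\<rightarrow> NatT \<^bold>\<rightarrow> \<sigma>) \<^bold>\<rightarrow> NatT \<^bold>\<rightarrow> \<sigma>"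
| "const_ty CMin = (NatT \<^bold>\<rightarrow> NatT) \<^bold>\<rightarrow> NatT \<^bold>\<rightarrow> NatT"
| "const_ty CByval = (NatT \<^bold>\<rightarrow> NatT) \<^bold>\<rightarrow> NatT \<^bold>\<rightarrow> NatT"
| "const_ty CRecstr = NatT \<^bold>\<rightarrow> (NatT \<^bold>\<rightarrow> NatT \<^bold>\<rightarrow> NatT) \<^bold>\<rightarrow> NatT \<^bold>\<rightarrow> NatT"

definition base_consts :: "const set" where
  "base_consts = range CNum \<union> {CSuc, CPre, CIfzero}"

definition T_min :: "const set" where
  "T_min = base_consts \<union> range CRec \<union> {CMin}"

definition T0_str :: "const set" where
  "T0_str = base_consts \<union> {CByval, CRecstr}"

text \<open>Terms of the union of both languages, with de Bruijn indices.\<close>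

datatype tm =
    Var nat
  | Con const
  | App tm tm  (infixl "\<^bold>\<cdot>" 200)
  | Lam ty tm

abbreviation Num :: "nat \<Rightarrow> tm" where
  "Num n \<equiv> Con (CNum n)"

inductive typed :: "ty list \<Rightarrow> tm \<Rightarrow> ty \<Rightarrow> bool" where
  Var: "i < length \<Gamma> \<Longrightarrow> typed \<Gamma> (Var i) (\<Gamma> ! i)"
| Con: "typed \<Gamma> (Con c) (const_ty c)"
| App: "typed \<Gamma> M (\<sigma> \<^bold>\<rightarrow> \<tau>) \<Longrightarrow> typed \<Gamma> N \<sigma> \<Longrightarrow> typed \<Gamma> (M \<^bold>\<cdot> N) \<tau>"
| Lam: "typed (\<sigma> # \<Gamma>) M \<tau> \<Longrightarrow> typed \<Gamma> (Lam \<sigma> M) (\<sigma> \<^bold>\<rightarrow> \<tau>)"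

fun constants_of :: "tm \<Rightarrow> const set" where
  "constants_of (Var i) = {}"
| "constants_of (Con c) = {c}"
| "constants_of (M \<^bold>\<cdot> N) = constants_of M \<union> constants_of N"
| "constants_of (Lam \<sigma> M) = constants_of M"

definition closed_term :: "const set \<Rightarrow> tm \<Rightarrow> ty \<Rightarrow> bool" where
  "closed_term L M \<sigma> \<longleftrightarrow> typed [] M \<sigma> \<and> constants_of M \<subseteq> L"

text \<open>\<open>lift k M\<close> increments the free indices \<open>\<ge> k\<close>; \<open>subst k P M\<close> replaces index \<open>k\<close> by
  \<open>P\<close> and decrements the larger ones.\<close>

fun lift :: "nat \<Rightarrow> tm \<Rightarrow> tm" where
  "lift k (Var i) = Var (if i < k then i else Suc i)"
| "lift k (Con c) = Con c"
| "lift k (M \<^bold>\<cdot> N) = lift k M \<^bold>\<cdot> lift k N"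
| "lift k (Lam \<sigma> M) = Lam \<sigma> (lift (Suc k) M)"

fun subst :: "nat \<Rightarrow> tm \<Rightarrow> tm \<Rightarrow> tm" where
  "subst k P (Var i) = (if i < k then Var i else if i = k then P else Var (i - 1))"
| "subst k P (Con c) = Con c"
| "subst k P (M \<^bold>\<cdot> N) = subst k P M \<^bold>\<cdot> subst k P N"
| "subst k P (Lam \<sigma> M) = Lam \<sigma> (subst (Suc k) (lift 0 P) M)"

inductive step :: "tm \<Rightarrow> tm \<Rightarrow> bool"  (infix "\<leadsto>" 50) where
  beta: "Lam \<sigma> M \<^bold>\<cdot> N \<leadsto> subst 0 N M"
| suc: "Con CSuc \<^bold>\<cdot> Num n \<leadsto> Num (n + 1)"
| pre_suc: "Con CPre \<^bold>\<cdot> Num (n + 1) \<leadsto> Num n"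
| pre_0: "Con CPre \<^bold>\<cdot> Num 0 \<leadsto> Num 0"
| ifzero_0: "Con CIfzero \<^bold>\<cdot> Num 0 \<leadsto> Lam NatT (Lam NatT (Var 1))"
| ifzero_suc: "Con CIfzero \<^bold>\<cdot> Num (n + 1) \<leadsto> Lam NatT (Lam NatT (Var 0))"
| rec_0: "Con (CRec \<sigma>) \<^bold>\<cdot> X \<^bold>\<cdot> F \<^bold>\<cdot> Num 0 \<leadsto> X"
| rec_suc: "Con (CRec \<sigma>) \<^bold>\<cdot> X \<^bold>\<cdot> F \<^bold>\<cdot> Num (n + 1)
    \<leadsto> F \<^bold>\<cdot> (Con (CRec \<sigma>) \<^bold>\<cdot> X \<^bold>\<cdot> F \<^bold>\<cdot> Num n) \<^bold>\<cdot> Num n"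
| min: "Con CMin \<^bold>\<cdot> F \<^bold>\<cdot> Num n
    \<leadsto> Con CIfzero \<^bold>\<cdot> (F \<^bold>\<cdot> Num n) \<^bold>\<cdot> Num n \<^bold>\<cdot> (Con CMin \<^bold>\<cdot> F \<^bold>\<cdot> (Con CSuc \<^bold>\<cdot> Num n))"
| byval: "Con CByval \<^bold>\<cdot> F \<^bold>\<cdot> Num n \<leadsto> F \<^bold>\<cdot> Num n"
| recstr_0: "Con CRecstr \<^bold>\<cdot> X \<^bold>\<cdot> F \<^bold>\<cdot> Num 0 \<leadsto> X"
| recstr_suc: "Con CRecstr \<^bold>\<cdot> X \<^bold>\<cdot> F \<^bold>\<cdot> Num (n + 1)
    \<leadsto> Con CByval \<^bold>\<cdot> Lam NatT (lift 0 F \<^bold>\<cdot> Var 0 \<^bold>\<cdot> Num n) \<^bold>\<cdot> (Con CRecstr \<^bold>\<cdot> X \<^bold>\<cdot> F \<^bold>\<cdot> Num n)"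
| ctx_app: "M \<leadsto> M' \<Longrightarrow> M \<^bold>\<cdot> N \<leadsto> M' \<^bold>\<cdot> N"
| ctx_suc: "M \<leadsto> M' \<Longrightarrow> Con CSuc \<^bold>\<cdot> M \<leadsto> Con CSuc \<^bold>\<cdot> M'"
| ctx_pre: "M \<leadsto> M' \<Longrightarrow> Con CPre \<^bold>\<cdot> M \<leadsto> Con CPre \<^bold>\<cdot> M'"
| ctx_ifzero: "M \<leadsto> M' \<Longrightarrow> Con CIfzero \<^bold>\<cdot> M \<leadsto> Con CIfzero \<^bold>\<cdot> M'"
| ctx_rec: "M \<leadsto> M' \<Longrightarrow> Con (CRec \<sigma>) \<^bold>\<cdot> X \<^bold>\<cdot> F \<^bold>\<cdot> M \<leadsto> Con (CRec \<sigma>) \<^bold>\<cdot> X \<^bold>\<cdot> F \<^bold>\<cdot> M'"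
| ctx_min: "M \<leadsto> M' \<Longrightarrow> Con CMin \<^bold>\<cdot> F \<^bold>\<cdot> M \<leadsto> Con CMin \<^bold>\<cdot> F \<^bold>\<cdot> M'"
| ctx_byval: "M \<leadsto> M' \<Longrightarrow> Con CByval \<^bold>\<cdot> F \<^bold>\<cdot> M \<leadsto> Con CByval \<^bold>\<cdot> F \<^bold>\<cdot> M'"
| ctx_recstr: "M \<leadsto> M' \<Longrightarrow> Con CRecstr \<^bold>\<cdot> X \<^bold>\<cdot> F \<^bold>\<cdot> M \<leadsto> Con CRecstr \<^bold>\<cdot> X \<^bold>\<cdot> F \<^bold>\<cdot> M'"

definition evaluates :: "tm \<Rightarrow> nat \<Rightarrow> bool" where
  "evaluates M n \<longleftrightarrow> step\<^sup>*\<^sup>* M (Num n)"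

definition eval_eq :: "tm \<Rightarrow> tm \<Rightarrow> bool" where
  "eval_eq M M' \<longleftrightarrow> (\<exists>n. evaluates M n \<and> evaluates M' n)"

text \<open>Primitive recursive functions act on argument lists of any length; missing arguments
  read as \<open>0\<close>. An \<open>n\<close>-ary function is primitive recursive iff it agrees on lists of length \<open>n\<close>
  with one of these.\<close>

definition arg :: "nat \<Rightarrow> nat list \<Rightarrow> nat" where
  "arg i xs = (if i < length xs then xs ! i else 0)"

inductive prim_rec :: "(nat list \<Rightarrow> nat) \<Rightarrow> bool" where
  zero: "prim_rec (\<lambda>xs. 0)"
| succ: "prim_rec (\<lambda>xs. Suc (arg 0 xs))"
| proj: "prim_rec (arg i)"
| comp: "prim_rec g \<Longrightarrow> \<forall>f\<in>set fs. prim_rec f \<Longrightarrow> prim_rec (\<lambda>xs. g (map (\<lambda>f. f xs) fs))"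
| recur: "prim_rec f \<Longrightarrow> prim_rec g \<Longrightarrow>
    prim_rec (\<lambda>xs. rec_nat (f (tl xs)) (\<lambda>m r. g (m # r # tl xs)) (arg 0 xs))"

text \<open>Primitive recursiveness of the set of codes, and of \<open>code\<close> on sequences of each fixed
  length, follows from the three conditions on length, entries and extension.\<close>

definition prim_rec_coding :: "(nat list \<Rightarrow> nat) \<Rightarrow> bool" where
  "prim_rec_coding code \<longleftrightarrow> inj code \<and>
     (\<exists>len. prim_rec len \<and> (\<forall>xs. len [code xs] = length xs)) \<and>
     (\<exists>entry. prim_rec entry \<and> (\<forall>xs. \<forall>i<length xs. entry [code xs, i] = xs ! i)) \<and>
     (\<exists>snoc. prim_rec snoc \<and> (\<forall>xs z. snoc [code xs, z] = code (xs @ [z])))"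

definition is_add :: "(nat list \<Rightarrow> nat) \<Rightarrow> tm \<Rightarrow> bool" where
  "is_add code add \<longleftrightarrow> closed_term T0_str add (NatT \<^bold>\<rightarrow> NatT \<^bold>\<rightarrow> NatT) \<and>
     (\<forall>xs z. evaluates (add \<^bold>\<cdot> Num (code xs) \<^bold>\<cdot> Num z) (code (xs @ [z])))"

definition is_basic :: "(nat list \<Rightarrow> nat) \<Rightarrow> tm \<Rightarrow> bool" where
  "is_basic code basic \<longleftrightarrow> closed_term T0_str basic (NatT \<^bold>\<rightarrow> NatT \<^bold>\<rightarrow> NatT \<^bold>\<rightarrow> NatT) \<and>
     (\<forall>xs j i. evaluates (basic \<^bold>\<cdot> Num (code xs) \<^bold>\<cdot> Num j \<^bold>\<cdot> Num i)
                 (if i < length xs then xs ! i else j))"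

definition kohlenbach_bar :: "(nat list \<Rightarrow> nat) \<Rightarrow> tm \<Rightarrow> tm \<Rightarrow> nat list \<Rightarrow> bool" where
  "kohlenbach_bar code basic F xs \<longleftrightarrow>
     eval_eq (F \<^bold>\<cdot> (basic \<^bold>\<cdot> Num (code xs) \<^bold>\<cdot> Num 0)) (F \<^bold>\<cdot> (basic \<^bold>\<cdot> Num (code xs) \<^bold>\<cdot> Num 1))"

definition kohlenbach_tree :: "(nat list \<Rightarrow> nat) \<Rightarrow> tm \<Rightarrow> tm \<Rightarrow> nat list set" where
  "kohlenbach_tree code basic F =
     {xs. \<forall>ys. strict_prefix ys xs \<longrightarrow> \<not> kohlenbach_bar code basic F ys}"

definition well_founded_tree :: "nat list set \<Rightarrow> bool" where
  "well_founded_tree T \<longleftrightarrow> \<not> (\<exists>x :: nat \<Rightarrow> nat. \<forall>n. map x [0..<n] \<in> T)"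

definition leaves :: "nat list set \<Rightarrow> nat list set" where
  "leaves T = {xs \<in> T. \<forall>y. xs @ [y] \<notin> T}"

definition internal_nodes :: "nat list set \<Rightarrow> nat list set" where
  "internal_nodes T = {xs \<in> T. \<forall>y. xs @ [y] \<in> T}"

end

theory Submission
  imports Defs
begin

text \<open>Evaluate a \<open>T_min\<close> term \<open>BR f g x\<close> with \<open>f\<close>, \<open>g\<close> oracles of type 2. Recursors and minimization may
  make unboundedly many oracle calls one after another, but a reducibility argument shows that the
  nesting of calls inside arguments of calls is well-founded, whatever the oracles answer.
  An adversary answers with \<open>F\<close> and \<open>G\<close> built from a finite path \<open>s\<close> and a secret \<open>c\<close>: the
  Kohlenbach tree of \<open>F\<close> consists of the prefixes of \<open>s\<close> and their children, and \<open>G\<close> passes \<open>c\<close> up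
  from \<open>s\<close> to the root, so that bar recursion has the value \<open>c\<close> at every prefix of \<open>s\<close>. The next entry
  of \<open>s\<close> is disclosed only inside the argument of a call to \<open>G\<close>, so reaching \<open>c\<close> requires
  nested calls to the depth \<open>length s\<close>. By induction on the nesting, every computation
  is decided by some path: along all further extensions it either diverges for \<open>c = 0\<close>, or has the same
  value for \<open>c = 0\<close> and all large \<open>c\<close>. Applied to bar recursion at the root, both are absurd.\<close>

text \<open>\<open>min\<close> makes terms partial and leaves the length of a computation unbounded,
  so the induction can only run over the nesting, and divergence has to be one of the outcomes. The
  secret 0 serves as reference: under it every defined answer of \<open>G\<close> is 0, whatever the
  path. A run that converges under a path \<open>s0\<close> and the secret 0 is replayed under
  longer paths, whose next entry \<open>x\<close> is chosen after the run and large compared to it.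
  A call that knows \<open>s0\<close> now triggers a query at \<open>x\<close> instead of meeting
  the end of the path. The old run says nothing about this query, but it lies one level deeper in
  the nesting, so the induction hypothesis applies: either it diverges under 0, and the whole
  computation with it, or it has a fixed value \<open>u\<close>, and every secret above
  \<open>u\<close> then leads to the answer 0 as before. Hence the asymmetry: divergence is claimed
  for the secret 0 only, convergence for 0 and all large secrets.\<close>

section \<open>Closed terms\<close>

fun cl :: "nat \<Rightarrow> tm \<Rightarrow> bool" where
  "cl k (Var i) \<longleftrightarrow> i < k"
| "cl k (Con c) \<longleftrightarrow> True"
| "cl k (M \<^bold>\<cdot> N) \<longleftrightarrow> cl k M \<and> cl k N"
| "cl k (Lam \<sigma> M) \<longleftrightarrow> cl (Suc k) M"

lemma cl_mono: "cl k M \<Longrightarrow> k \<le> k' \<Longrightarrow> cl k' M"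
  by (induction k M arbitrary: k' rule: cl.induct) auto

lemma lift_cl: "cl k M \<Longrightarrow> k \<le> i \<Longrightarrow> lift i M = M"
  by (induction k M arbitrary: i rule: cl.induct) auto

lemma subst_cl: "cl k M \<Longrightarrow> k \<le> i \<Longrightarrow> subst i P M = M"
  by (induction k M arbitrary: i P rule: cl.induct) auto

lemma typed_cl: "typed \<Gamma> M \<sigma> \<Longrightarrow> cl (length \<Gamma>) M"
  by (induction rule: typed.induct) auto

lemma closed_term_cl: "closed_term L M \<sigma> \<Longrightarrow> cl 0 M"
  using typed_cl[of "[]"] by (auto simp: closed_term_def)

lemma subst_lift [simp]: "subst k N (lift k M) = M"
  by (induction M arbitrary: k N) auto

lemma lift_lift: "i \<le> k \<Longrightarrow> lift (Suc k) (lift i M) = lift i (lift k M)"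
  by (induction M arbitrary: i k) auto

lemma subst_lift_comm: "i \<le> k \<Longrightarrow> subst (Suc k) (lift i N) (lift i M) = lift i (subst k N M)"
  by (induction M arbitrary: i k N) (auto simp: lift_lift[of 0, symmetric])

section \<open>The reduction relation\<close>

lemma no_step_Con [simp]: "\<not> Con c \<leadsto> M"
  and no_step_Lam [simp]: "\<not> Lam \<sigma> N \<leadsto> M"
  by (auto elim: step.cases)

lemma no_step_Con1 [simp]:
  "c \<noteq> CSuc \<Longrightarrow> c \<noteq> CPre \<Longrightarrow> c \<noteq> CIfzero \<Longrightarrow> \<not> Con c \<^bold>\<cdot> X \<leadsto> M"
  by (auto elim: step.cases)

lemma no_step_Con2 [simp]: "\<not> Con (CRec \<sigma>) \<^bold>\<cdot> X \<^bold>\<cdot> Y \<leadsto> M" "\<not> Con CRecstr \<^bold>\<cdot> X \<^bold>\<cdot> Y \<leadsto> M"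
  by (auto elim: step.cases)

lemma step_det: "M \<leadsto> M1 \<Longrightarrow> M \<leadsto> M2 \<Longrightarrow> M1 = M2"
proof (induction arbitrary: M2 rule: step.induct)
  case (ctx_app M M')
  from ctx_app.prems show ?case
    by cases (use ctx_app.hyps in \<open>auto dest: ctx_app.IH\<close>)
next
  case (ctx_suc M M')
  from ctx_suc.prems show ?case
    by cases (use ctx_suc.hyps in \<open>auto dest: ctx_suc.IH\<close>)
next
  case (ctx_pre M M')
  from ctx_pre.prems show ?case
    by cases (use ctx_pre.hyps in \<open>auto dest: ctx_pre.IH\<close>)
next
  case (ctx_ifzero M M')
  from ctx_ifzero.prems show ?case
    by cases (use ctx_ifzero.hyps in \<open>auto dest: ctx_ifzero.IH\<close>)
next
  case (ctx_rec M M')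
  from ctx_rec.prems show ?case
    by cases (use ctx_rec.hyps in \<open>auto dest: ctx_rec.IH\<close>)
next
  case (ctx_min M M')
  from ctx_min.prems show ?case
    by cases (use ctx_min.hyps in \<open>auto dest: ctx_min.IH\<close>)
next
  case (ctx_byval M M')
  from ctx_byval.prems show ?case
    by cases (use ctx_byval.hyps in \<open>auto dest: ctx_byval.IH\<close>)
next
  case (ctx_recstr M M')
  from ctx_recstr.prems show ?case
    by cases (use ctx_recstr.hyps in \<open>auto dest: ctx_recstr.IH\<close>)
qed (erule step.cases; simp)+

text \<open>By determinism every reduct of \<open>M\<close> lies on the one run from
  \<open>M\<close> to its value. The length bound serves the later induction on run length.\<close>

lemma steps_strip:
  assumes "step\<^sup>*\<^sup>* M M'" and "(step ^^ n) M (Num v)"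
  shows "\<exists>n'\<le>n. (step ^^ n') M' (Num v)"
  using assms
proof (induction arbitrary: n rule: converse_rtranclp_induct)
  case (step Y Z)
  from step.prems step.hyps(1) obtain m Z' where "n = Suc m" "Y \<leadsto> Z'" "(step ^^ m) Z' (Num v)"
    by (auto elim: relpowp_E2)
  with step.hyps(1) step_det have "(step ^^ m) Z (Num v)" by metis
  from step.IH[OF this] \<open>n = Suc m\<close> show ?case by (meson le_Suc_eq le_trans)
qed auto

lemma evaluates_relpowp: "evaluates M v \<longleftrightarrow> (\<exists>n. (step ^^ n) M (Num v))"
  by (simp add: evaluates_def rtranclp_power)

lemma evaluates_expand: "step\<^sup>*\<^sup>* M M' \<Longrightarrow> evaluates M' v \<Longrightarrow> evaluates M v"
  by (simp add: evaluates_def)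

lemma evaluates_reduce: "step\<^sup>*\<^sup>* M M' \<Longrightarrow> evaluates M v \<Longrightarrow> evaluates M' v"
  by (meson evaluates_relpowp steps_strip)

lemma evaluates_Num [simp]: "evaluates (Num m) n \<longleftrightarrow> m = n"
  by (auto simp: evaluates_def elim: converse_rtranclpE)

lemma evaluates_det: "evaluates M m \<Longrightarrow> evaluates M n \<Longrightarrow> m = n"
  using evaluates_Num evaluates_reduce unfolding evaluates_def by blast


text \<open>Evaluation is stuck at an argument of \<open>byval\<close> that has no numeral as its value.\<close>

inductive blocked :: "tm \<Rightarrow> bool" where
  base: "\<nexists>X'. X \<leadsto> X' \<Longrightarrow> \<forall>a. X \<noteq> Num a \<Longrightarrow> blocked (Con CByval \<^bold>\<cdot> B \<^bold>\<cdot> X)"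
| app: "blocked M \<Longrightarrow> blocked (M \<^bold>\<cdot> N)"
| suc: "blocked M \<Longrightarrow> blocked (Con CSuc \<^bold>\<cdot> M)"
| pre: "blocked M \<Longrightarrow> blocked (Con CPre \<^bold>\<cdot> M)"
| ifzero: "blocked M \<Longrightarrow> blocked (Con CIfzero \<^bold>\<cdot> M)"
| rec: "blocked M \<Longrightarrow> blocked (Con (CRec \<sigma>) \<^bold>\<cdot> X \<^bold>\<cdot> F \<^bold>\<cdot> M)"
| min: "blocked M \<Longrightarrow> blocked (Con CMin \<^bold>\<cdot> F \<^bold>\<cdot> M)"

lemma not_blocked_Con [simp]: "\<not> blocked (Con c)"
  and not_blocked_Lam [simp]: "\<not> blocked (Lam \<sigma> N)"
  by (auto elim: blocked.cases)

lemma not_blocked_Con1 [simp]: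
  "c \<noteq> CSuc \<Longrightarrow> c \<noteq> CPre \<Longrightarrow> c \<noteq> CIfzero \<Longrightarrow> \<not> blocked (Con c \<^bold>\<cdot> X)"
  by (auto elim: blocked.cases)

lemma not_blocked_Con2 [simp]:
  "\<not> blocked (Con (CRec \<sigma>) \<^bold>\<cdot> X \<^bold>\<cdot> Y)" "\<not> blocked (Con CRecstr \<^bold>\<cdot> X \<^bold>\<cdot> Y)"
  by (auto elim: blocked.cases)

lemma not_blocked_ConNum [simp]: "\<not> blocked (Con c \<^bold>\<cdot> Num n)"
  by (auto elim: blocked.cases)

lemma blocked_no_step: "blocked M \<Longrightarrow> \<not> M \<leadsto> M'"
proof (induction arbitrary: M' rule: blocked.induct)
  case (base X B)
  then show ?case by (auto elim: step.cases)
next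
  case (app M N)
  show ?case
  proof
    assume "M \<^bold>\<cdot> N \<leadsto> M'"
    then show False by cases (use app.hyps app.IH in auto)
  qed
next
  case (suc M)
  show ?case
  proof
    assume "Con CSuc \<^bold>\<cdot> M \<leadsto> M'"
    then show False by cases (use suc.hyps suc.IH in auto)
  qed
next
  case (pre M)
  show ?case
  proof
    assume "Con CPre \<^bold>\<cdot> M \<leadsto> M'"
    then show False by cases (use pre.hyps pre.IH in auto)
  qed
next
  case (ifzero M)
  show ?case
  proof
    assume "Con CIfzero \<^bold>\<cdot> M \<leadsto> M'"
    then show False by cases (use ifzero.hyps ifzero.IH in auto)
  qed
next
  case (rec M \<sigma> X F)
  show ?case
  proof
    assume "Con (CRec \<sigma>) \<^bold>\<cdot> X \<^bold>\<cdot> F \<^bold>\<cdot> M \<leadsto> M'"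
    then show False by cases (use rec.hyps rec.IH in auto)
  qed
next
  case (min M F)
  show ?case
  proof
    assume "Con CMin \<^bold>\<cdot> F \<^bold>\<cdot> M \<leadsto> M'"
    then show False by cases (use min.hyps min.IH in auto)
  qed
qed

text \<open>Evaluation contexts by their behaviour: steps pass through \<open>E\<close>, and a stuck
  \<open>byval\<close> stays stuck inside \<open>E\<close>, so that evaluation cannot bypass its
  argument.\<close>

definition ectx :: "(tm \<Rightarrow> tm) \<Rightarrow> bool" where
  "ectx E \<longleftrightarrow> (\<forall>X Y. X \<leadsto> Y \<longrightarrow> E X \<leadsto> E Y) \<and> (\<forall>X. blocked X \<longrightarrow> blocked (E X))"

lemma steps_ctx:
  "step\<^sup>*\<^sup>* X Y \<Longrightarrow> (\<And>X Y. X \<leadsto> Y \<Longrightarrow> E X \<leadsto> E Y) \<Longrightarrow> step\<^sup>*\<^sup>* (E X) (E Y)"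
  by (induction rule: rtranclp_induct) (auto intro: rtranclp.rtrancl_into_rtrancl)

lemma ectx_steps: "ectx E \<Longrightarrow> step\<^sup>*\<^sup>* X Y \<Longrightarrow> step\<^sup>*\<^sup>* (E X) (E Y)"
  by (rule steps_ctx) (simp_all add: ectx_def)

lemma ectx_id: "ectx (\<lambda>X. X)"
  by (simp add: ectx_def)

lemma ectx_comp: "ectx E \<Longrightarrow> ectx E' \<Longrightarrow> ectx (\<lambda>X. E (E' X))"
  by (simp add: ectx_def)

lemma ectx_frames:
  "ectx (\<lambda>X. X \<^bold>\<cdot> N)" "ectx (\<lambda>X. Con CSuc \<^bold>\<cdot> X)" "ectx (\<lambda>X. Con CPre \<^bold>\<cdot> X)"
  "ectx (\<lambda>X. Con CIfzero \<^bold>\<cdot> X)" "ectx (\<lambda>X. Con (CRec \<sigma>) \<^bold>\<cdot> Y \<^bold>\<cdot> F \<^bold>\<cdot> X)"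
  "ectx (\<lambda>X. Con CMin \<^bold>\<cdot> F \<^bold>\<cdot> X)"
  by (auto simp: ectx_def intro: step.intros blocked.intros)

text \<open>Strictness of \<open>byval\<close>: a run of the whole contains a run of the argument.
  Since the lengths add up, the run of a query is available to an induction on run length.\<close>

lemma byval_split:
  assumes "ectx E" and "(step ^^ n) (E (Con CByval \<^bold>\<cdot> B \<^bold>\<cdot> X)) (Num v)"
  shows "\<exists>a m n'. (step ^^ m) X (Num a) \<and> (step ^^ n') (E (Con CByval \<^bold>\<cdot> B \<^bold>\<cdot> Num a)) (Num v) \<and> m + n' = n"
  using assms(2)
proof (induction n arbitrary: X)
  case 0
  show ?case
  proof (cases "\<exists>a. X = Num a")
    case True
    with 0 show ?thesis by (metis add_0 relpowp_0_I)
  next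
    case nonnum: False
    show ?thesis
    proof (cases "\<exists>X'. X \<leadsto> X'")
      case True
      then obtain X' where "E (Con CByval \<^bold>\<cdot> B \<^bold>\<cdot> X) \<leadsto> E (Con CByval \<^bold>\<cdot> B \<^bold>\<cdot> X')"
        using assms(1) step.ctx_byval unfolding ectx_def by blast
      with 0 show ?thesis by simp
    next
      case False
      then have "blocked (E (Con CByval \<^bold>\<cdot> B \<^bold>\<cdot> X))"
        using nonnum assms(1) by (simp add: ectx_def blocked.base)
      with 0 show ?thesis by simp
    qed
  qed
next
  case (Suc n)
  show ?case
  proof (cases "\<exists>a. X = Num a")
    case True
    with Suc.prems show ?thesis by (metis add_0 relpowp_0_I)
  next
    case nonnum: False
    from Suc.prems obtain Z where Z: "E (Con CByval \<^bold>\<cdot> B \<^bold>\<cdot> X) \<leadsto> Z" "(step ^^ n) Z (Num v)"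
      by (meson relpowp_Suc_D2)
    show ?thesis
    proof (cases "\<exists>X'. X \<leadsto> X'")
      case True
      then obtain X' where X': "X \<leadsto> X'" by blast
      then have "E (Con CByval \<^bold>\<cdot> B \<^bold>\<cdot> X) \<leadsto> E (Con CByval \<^bold>\<cdot> B \<^bold>\<cdot> X')"
        using assms(1) step.ctx_byval unfolding ectx_def by blast
      with Z step_det have "(step ^^ n) (E (Con CByval \<^bold>\<cdot> B \<^bold>\<cdot> X')) (Num v)" by metis
      from Suc.IH[OF this] obtain a m n' where
        "(step ^^ m) X' (Num a)" "(step ^^ n') (E (Con CByval \<^bold>\<cdot> B \<^bold>\<cdot> Num a)) (Num v)" "m + n' = n"
        by blast
      with X' show ?thesis by (metis add_Suc relpowp_Suc_I2)
    next
      case False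
      then have "blocked (E (Con CByval \<^bold>\<cdot> B \<^bold>\<cdot> X))"
        using nonnum assms(1) by (simp add: ectx_def blocked.base)
      with Z show ?thesis using blocked_no_step by blast
    qed
  qed
qed

section \<open>Replacing an argument by its value\<close>

text \<open>By call by name, \<open>BR F G\<close> receives the unevaluated argument \<open>add x z\<close> instead of a numeral. In
  \<open>rp t k M M'\<close>, \<open>M'\<close> has the numeral \<open>k\<close> for some occurrences of \<open>t\<close> in \<open>M\<close>.\<close>

inductive rp :: "tm \<Rightarrow> nat \<Rightarrow> tm \<Rightarrow> tm \<Rightarrow> bool" for t k where
  here: "rp t k t (Num k)"
| Var: "rp t k (Var i) (Var i)"
| Con: "rp t k (Con c) (Con c)"
| App: "rp t k M M' \<Longrightarrow> rp t k N N' \<Longrightarrow> rp t k (M \<^bold>\<cdot> N) (M' \<^bold>\<cdot> N')"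
| Lam: "rp t k M M' \<Longrightarrow> rp t k (Lam \<sigma> M) (Lam \<sigma> M')"

lemma rp_App_iff [simp]:
  "rp t k M (A \<^bold>\<cdot> B) \<longleftrightarrow> (\<exists>A0 B0. M = A0 \<^bold>\<cdot> B0 \<and> rp t k A0 A \<and> rp t k B0 B)"
  by (auto elim: rp.cases intro: rp.intros)

lemma rp_Lam_iff [simp]: "rp t k M (Lam \<sigma> A) \<longleftrightarrow> (\<exists>A0. M = Lam \<sigma> A0 \<and> rp t k A0 A)"
  by (auto elim: rp.cases intro: rp.intros)

lemma rp_Con [simp]: "c \<noteq> CNum k \<Longrightarrow> rp t k M (Con c) \<longleftrightarrow> M = Con c"
  by (auto elim: rp.cases intro: rp.intros)

lemma rp_Num: "rp t k M (Num n) \<Longrightarrow> M = Num n \<or> M = t \<and> n = k"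
  by (auto elim: rp.cases)

lemma rp_refl: "rp t k M M"
  by (induction M) (auto intro: rp.intros)

lemma rp_lift: "rp t k M M' \<Longrightarrow> cl 0 t \<Longrightarrow> rp t k (lift i M) (lift i M')"
  by (induction arbitrary: i rule: rp.induct) (auto simp: lift_cl intro: rp.intros)

lemma rp_subst:
  "rp t k M M' \<Longrightarrow> cl 0 t \<Longrightarrow> rp t k N N' \<Longrightarrow> rp t k (subst i N M) (subst i N' M')"
proof (induction arbitrary: i N N' rule: rp.induct)
  case (Lam M M' \<sigma>)
  then show ?case by (simp add: rp_lift)
qed (auto simp: subst_cl intro: rp.intros)

lemma rp_redex:
  assumes "rp t k Y (Num n)" and "\<And>X X'. X \<leadsto> X' \<Longrightarrow> f X \<leadsto> f X'" and "f (Num n) \<leadsto> R"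
    and t: "step\<^sup>*\<^sup>* t (Num k)"
  shows "step\<^sup>*\<^sup>* (f Y) R"
proof -
  have "step\<^sup>*\<^sup>* Y (Num n)" using rp_Num[OF assms(1)] t by auto
  from steps_ctx[of Y "Num n" f, OF this assms(2)] assms(3) show ?thesis by simp
qed

text \<open>A numeral consumed by a step may stand for \<open>t\<close> on the other side, where it
  must first be computed; hence one step is matched by several. This direction suffices, as the
  values of bar recursion are known at numerals and wanted at unevaluated arguments.\<close>

lemma rp_step:
  assumes "cl 0 t" and t: "step\<^sup>*\<^sup>* t (Num k)"
  shows "M' \<leadsto> N' \<Longrightarrow> rp t k M M' \<Longrightarrow> \<exists>N. step\<^sup>*\<^sup>* M N \<and> rp t k N N'"
proof (induction arbitrary: M rule: step.induct)
  case (beta \<sigma> B N)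
  then obtain B0 N0 where M: "M = Lam \<sigma> B0 \<^bold>\<cdot> N0" "rp t k B0 B" "rp t k N0 N" by auto
  with rp_subst[OF M(2) assms(1) M(3)] show ?case using step.beta by blast
next
  case (suc n)
  then obtain Y where M: "M = Con CSuc \<^bold>\<cdot> Y" "rp t k Y (Num n)"
    by auto
  have "step\<^sup>*\<^sup>* M (Num (n + 1))"
    unfolding M(1)
    by (rule rp_redex[where f = "\<lambda>Y. Con CSuc \<^bold>\<cdot> Y", OF M(2) _ _ t])
      (erule step.ctx_suc, rule step.suc)
  with M show ?case by (blast intro: rp_refl)
next
  case (pre_suc n)
  then obtain Y where M: "M = Con CPre \<^bold>\<cdot> Y" "rp t k Y (Num (n + 1))"
    by auto
  have "step\<^sup>*\<^sup>* M (Num n)"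
    unfolding M(1)
    by (rule rp_redex[where f = "\<lambda>Y. Con CPre \<^bold>\<cdot> Y", OF M(2) _ _ t])
      (erule step.ctx_pre, rule step.pre_suc)
  with M show ?case by (blast intro: rp_refl)
next
  case (pre_0)
  then obtain Y where M: "M = Con CPre \<^bold>\<cdot> Y" "rp t k Y (Num 0)"
    by auto
  have "step\<^sup>*\<^sup>* M (Num 0)"
    unfolding M(1)
    by (rule rp_redex[where f = "\<lambda>Y. Con CPre \<^bold>\<cdot> Y", OF M(2) _ _ t])
      (erule step.ctx_pre, rule step.pre_0)
  with M show ?case by (blast intro: rp_refl)
next
  case (ifzero_0)
  then obtain Y where M: "M = Con CIfzero \<^bold>\<cdot> Y" "rp t k Y (Num 0)"
    by auto
  have "step\<^sup>*\<^sup>* M (Lam NatT (Lam NatT (Var 1)))"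
    unfolding M(1)
    by (rule rp_redex[where f = "\<lambda>Y. Con CIfzero \<^bold>\<cdot> Y", OF M(2) _ _ t])
      (erule step.ctx_ifzero, rule step.ifzero_0)
  with M show ?case by (blast intro: rp_refl)
next
  case (ifzero_suc n)
  then obtain Y where M: "M = Con CIfzero \<^bold>\<cdot> Y" "rp t k Y (Num (n + 1))"
    by auto
  have "step\<^sup>*\<^sup>* M (Lam NatT (Lam NatT (Var 0)))"
    unfolding M(1)
    by (rule rp_redex[where f = "\<lambda>Y. Con CIfzero \<^bold>\<cdot> Y", OF M(2) _ _ t])
      (erule step.ctx_ifzero, rule step.ifzero_suc)
  with M show ?case by (blast intro: rp_refl)
next
  case (rec_0 \<sigma> X F)
  then obtain X0 F0 Y where M: "M = Con (CRec \<sigma>) \<^bold>\<cdot> X0 \<^bold>\<cdot> F0 \<^bold>\<cdot> Y" "rp t k X0 X" "rp t k F0 F" "rp t k Y (Num 0)"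
    by auto
  have "step\<^sup>*\<^sup>* M (X0)"
    unfolding M(1)
    by (rule rp_redex[where f = "\<lambda>Y. Con (CRec \<sigma>) \<^bold>\<cdot> X0 \<^bold>\<cdot> F0 \<^bold>\<cdot> Y", OF M(4) _ _ t])
      (erule step.ctx_rec, rule step.rec_0)
  with M show ?case by blast
next
  case (rec_suc \<sigma> X F n)
  then obtain X0 F0 Y where M: "M = Con (CRec \<sigma>) \<^bold>\<cdot> X0 \<^bold>\<cdot> F0 \<^bold>\<cdot> Y" "rp t k X0 X" "rp t k F0 F" "rp t k Y (Num (n + 1))"
    by auto
  have "step\<^sup>*\<^sup>* M (F0 \<^bold>\<cdot> (Con (CRec \<sigma>) \<^bold>\<cdot> X0 \<^bold>\<cdot> F0 \<^bold>\<cdot> Num n) \<^bold>\<cdot> Num n)"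
    unfolding M(1)
    by (rule rp_redex[where f = "\<lambda>Y. Con (CRec \<sigma>) \<^bold>\<cdot> X0 \<^bold>\<cdot> F0 \<^bold>\<cdot> Y", OF M(4) _ _ t])
      (erule step.ctx_rec, rule step.rec_suc)
  with M show ?case
    by (intro exI[of _ "F0 \<^bold>\<cdot> (Con (CRec \<sigma>) \<^bold>\<cdot> X0 \<^bold>\<cdot> F0 \<^bold>\<cdot> Num n) \<^bold>\<cdot> Num n"]) (auto intro: rp_refl rp_lift[OF _ assms(1)])
next
  case (min F n)
  then obtain F0 Y where M: "M = Con CMin \<^bold>\<cdot> F0 \<^bold>\<cdot> Y" "rp t k F0 F" "rp t k Y (Num n)"
    by auto
  have "step\<^sup>*\<^sup>* M (Con CIfzero \<^bold>\<cdot> (F0 \<^bold>\<cdot> Num n) \<^bold>\<cdot> Num n \<^bold>\<cdot> (Con CMin \<^bold>\<cdot> F0 \<^bold>\<cdot> (Con CSuc \<^bold>\<cdot> Num n)))"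
    unfolding M(1)
    by (rule rp_redex[where f = "\<lambda>Y. Con CMin \<^bold>\<cdot> F0 \<^bold>\<cdot> Y", OF M(3) _ _ t])
      (erule step.ctx_min, rule step.min)
  with M show ?case
    by (intro exI[of _ "Con CIfzero \<^bold>\<cdot> (F0 \<^bold>\<cdot> Num n) \<^bold>\<cdot> Num n \<^bold>\<cdot> (Con CMin \<^bold>\<cdot> F0 \<^bold>\<cdot> (Con CSuc \<^bold>\<cdot> Num n))"]) (auto intro: rp_refl rp_lift[OF _ assms(1)])
next
  case (byval F n)
  then obtain F0 Y where M: "M = Con CByval \<^bold>\<cdot> F0 \<^bold>\<cdot> Y" "rp t k F0 F" "rp t k Y (Num n)"
    by auto
  have "step\<^sup>*\<^sup>* M (F0 \<^bold>\<cdot> Num n)"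
    unfolding M(1)
    by (rule rp_redex[where f = "\<lambda>Y. Con CByval \<^bold>\<cdot> F0 \<^bold>\<cdot> Y", OF M(3) _ _ t])
      (erule step.ctx_byval, rule step.byval)
  with M show ?case
    by (intro exI[of _ "F0 \<^bold>\<cdot> Num n"]) (auto intro: rp_refl rp_lift[OF _ assms(1)])
next
  case (recstr_0 X F)
  then obtain X0 F0 Y where M: "M = Con CRecstr \<^bold>\<cdot> X0 \<^bold>\<cdot> F0 \<^bold>\<cdot> Y" "rp t k X0 X" "rp t k F0 F" "rp t k Y (Num 0)"
    by auto
  have "step\<^sup>*\<^sup>* M (X0)"
    unfolding M(1)
    by (rule rp_redex[where f = "\<lambda>Y. Con CRecstr \<^bold>\<cdot> X0 \<^bold>\<cdot> F0 \<^bold>\<cdot> Y", OF M(4) _ _ t])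
      (erule step.ctx_recstr, rule step.recstr_0)
  with M show ?case by blast
next
  case (recstr_suc X F n)
  then obtain X0 F0 Y where M: "M = Con CRecstr \<^bold>\<cdot> X0 \<^bold>\<cdot> F0 \<^bold>\<cdot> Y" "rp t k X0 X" "rp t k F0 F" "rp t k Y (Num (n + 1))"
    by auto
  have "step\<^sup>*\<^sup>* M (Con CByval \<^bold>\<cdot> Lam NatT (lift 0 F0 \<^bold>\<cdot> Var 0 \<^bold>\<cdot> Num n) \<^bold>\<cdot> (Con CRecstr \<^bold>\<cdot> X0 \<^bold>\<cdot> F0 \<^bold>\<cdot> Num n))"
    unfolding M(1)
    by (rule rp_redex[where f = "\<lambda>Y. Con CRecstr \<^bold>\<cdot> X0 \<^bold>\<cdot> F0 \<^bold>\<cdot> Y", OF M(4) _ _ t])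
      (erule step.ctx_recstr, rule step.recstr_suc)
  with M show ?case
    by (intro exI[of _ "Con CByval \<^bold>\<cdot> Lam NatT (lift 0 F0 \<^bold>\<cdot> Var 0 \<^bold>\<cdot> Num n) \<^bold>\<cdot> (Con CRecstr \<^bold>\<cdot> X0 \<^bold>\<cdot> F0 \<^bold>\<cdot> Num n)"]) (auto intro: rp_refl rp_lift[OF _ assms(1)])
next
  case (ctx_app A A' B)
  then obtain A0 B0 where M: "M = A0 \<^bold>\<cdot> B0" "rp t k A0 A" "rp t k B0 B" by auto
  from ctx_app.IH[OF M(2)] obtain N where N: "step\<^sup>*\<^sup>* A0 N" "rp t k N A'" by blast
  from N(1) have "step\<^sup>*\<^sup>* M (N \<^bold>\<cdot> B0)" unfolding M(1) by (rule steps_ctx) (rule step.ctx_app)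
  with N(2) M(3) show ?case by (intro exI[of _ "N \<^bold>\<cdot> B0"]) simp
next
  case (ctx_suc A A')
  then obtain Y where M: "M = Con CSuc \<^bold>\<cdot> Y" "rp t k Y A" by auto
  from ctx_suc.IH[OF M(2)] obtain N where N: "step\<^sup>*\<^sup>* Y N" "rp t k N A'" by blast
  from N(1) have "step\<^sup>*\<^sup>* M (Con CSuc \<^bold>\<cdot> N)"
    unfolding M(1) by (rule steps_ctx) (rule step.ctx_suc)
  with N(2) M show ?case by (intro exI[of _ "Con CSuc \<^bold>\<cdot> N"]) simp
next
  case (ctx_pre A A')
  then obtain Y where M: "M = Con CPre \<^bold>\<cdot> Y" "rp t k Y A" by auto
  from ctx_pre.IH[OF M(2)] obtain N where N: "step\<^sup>*\<^sup>* Y N" "rp t k N A'" by blast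
  from N(1) have "step\<^sup>*\<^sup>* M (Con CPre \<^bold>\<cdot> N)"
    unfolding M(1) by (rule steps_ctx) (rule step.ctx_pre)
  with N(2) M show ?case by (intro exI[of _ "Con CPre \<^bold>\<cdot> N"]) simp
next
  case (ctx_ifzero A A')
  then obtain Y where M: "M = Con CIfzero \<^bold>\<cdot> Y" "rp t k Y A" by auto
  from ctx_ifzero.IH[OF M(2)] obtain N where N: "step\<^sup>*\<^sup>* Y N" "rp t k N A'" by blast
  from N(1) have "step\<^sup>*\<^sup>* M (Con CIfzero \<^bold>\<cdot> N)"
    unfolding M(1) by (rule steps_ctx) (rule step.ctx_ifzero)
  with N(2) M show ?case by (intro exI[of _ "Con CIfzero \<^bold>\<cdot> N"]) simp
next
  case (ctx_rec A A' \<sigma> X F)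
  then obtain X0 F0 Y where M: "M = Con (CRec \<sigma>) \<^bold>\<cdot> X0 \<^bold>\<cdot> F0 \<^bold>\<cdot> Y" "rp t k X0 X" "rp t k F0 F" "rp t k Y A" by auto
  from ctx_rec.IH[OF M(4)] obtain N where N: "step\<^sup>*\<^sup>* Y N" "rp t k N A'" by blast
  from N(1) have "step\<^sup>*\<^sup>* M (Con (CRec \<sigma>) \<^bold>\<cdot> X0 \<^bold>\<cdot> F0 \<^bold>\<cdot> N)"
    unfolding M(1) by (rule steps_ctx) (rule step.ctx_rec)
  with N(2) M show ?case by (intro exI[of _ "Con (CRec \<sigma>) \<^bold>\<cdot> X0 \<^bold>\<cdot> F0 \<^bold>\<cdot> N"]) simp
next
  case (ctx_min A A' F)
  then obtain F0 Y where M: "M = Con CMin \<^bold>\<cdot> F0 \<^bold>\<cdot> Y" "rp t k F0 F" "rp t k Y A" by auto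
  from ctx_min.IH[OF M(3)] obtain N where N: "step\<^sup>*\<^sup>* Y N" "rp t k N A'" by blast
  from N(1) have "step\<^sup>*\<^sup>* M (Con CMin \<^bold>\<cdot> F0 \<^bold>\<cdot> N)"
    unfolding M(1) by (rule steps_ctx) (rule step.ctx_min)
  with N(2) M show ?case by (intro exI[of _ "Con CMin \<^bold>\<cdot> F0 \<^bold>\<cdot> N"]) simp
next
  case (ctx_byval A A' F)
  then obtain F0 Y where M: "M = Con CByval \<^bold>\<cdot> F0 \<^bold>\<cdot> Y" "rp t k F0 F" "rp t k Y A" by auto
  from ctx_byval.IH[OF M(3)] obtain N where N: "step\<^sup>*\<^sup>* Y N" "rp t k N A'" by blast
  from N(1) have "step\<^sup>*\<^sup>* M (Con CByval \<^bold>\<cdot> F0 \<^bold>\<cdot> N)"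
    unfolding M(1) by (rule steps_ctx) (rule step.ctx_byval)
  with N(2) M show ?case by (intro exI[of _ "Con CByval \<^bold>\<cdot> F0 \<^bold>\<cdot> N"]) simp
next
  case (ctx_recstr A A' X F)
  then obtain X0 F0 Y where M: "M = Con CRecstr \<^bold>\<cdot> X0 \<^bold>\<cdot> F0 \<^bold>\<cdot> Y" "rp t k X0 X" "rp t k F0 F" "rp t k Y A" by auto
  from ctx_recstr.IH[OF M(4)] obtain N where N: "step\<^sup>*\<^sup>* Y N" "rp t k N A'" by blast
  from N(1) have "step\<^sup>*\<^sup>* M (Con CRecstr \<^bold>\<cdot> X0 \<^bold>\<cdot> F0 \<^bold>\<cdot> N)"
    unfolding M(1) by (rule steps_ctx) (rule step.ctx_recstr)
  with N(2) M show ?case by (intro exI[of _ "Con CRecstr \<^bold>\<cdot> X0 \<^bold>\<cdot> F0 \<^bold>\<cdot> N"]) simp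
qed

lemma rp_evaluates:
  assumes "rp t k M M'" and "evaluates M' v" and "cl 0 t" and "evaluates t k"
  shows "evaluates M v"
proof -
  have "step\<^sup>*\<^sup>* M' (Num v)" using assms(2) by (simp add: evaluates_def)
  then show ?thesis
    using assms(1)
  proof (induction arbitrary: M rule: converse_rtranclp_induct)
    case base
    then show ?case using assms(4) rp_Num by (auto simp: evaluates_def)
  next
    case (step Y Z)
    from rp_step[OF assms(3) assms(4)[unfolded evaluates_def] step.hyps(1) step.prems]
    obtain N where "step\<^sup>*\<^sup>* M N" "rp t k N Z" by blast
    with step.IH evaluates_expand show ?case by blast
  qed
qed

section \<open>Decision trees for functionals of type 2\<close>

text \<open>A tree acts on the most recent answer of its argument; \<open>Echo\<close> returns that answer.\<close>

datatype dt = Ret nat | Echo | IfEq nat dt dt | Ask nat dt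

primrec run :: "(nat \<Rightarrow> nat \<Rightarrow> bool) \<Rightarrow> dt \<Rightarrow> nat \<Rightarrow> nat \<Rightarrow> bool" where
  "run Q (Ret m) a k \<longleftrightarrow> k = m"
| "run Q Echo a k \<longleftrightarrow> k = a"
| "run Q (IfEq c D D') a k \<longleftrightarrow> (if a = c then run Q D a k else run Q D' a k)"
| "run Q (Ask q D) a k \<longleftrightarrow> (\<exists>a'. Q q a' \<and> run Q D a' k)"

text \<open>An equality test by counting down. As \<open>pre\<close> maps 0 to 0, zero is ruled out
  before each decrement; otherwise values below \<open>c\<close> would pass for
  \<open>c\<close>.\<close>

fun ifeq :: "nat \<Rightarrow> tm \<Rightarrow> tm \<Rightarrow> tm \<Rightarrow> tm" where
  "ifeq 0 M A B = Con CIfzero \<^bold>\<cdot> M \<^bold>\<cdot> A \<^bold>\<cdot> B"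
| "ifeq (Suc k) M A B = Con CIfzero \<^bold>\<cdot> M \<^bold>\<cdot> B \<^bold>\<cdot> ifeq k (Con CPre \<^bold>\<cdot> M) A B"

text \<open>\<open>M\<close> is the term for the most recent answer. After an \<open>Ask\<close> it
  is the variable bound by \<open>byval\<close>, so each query is evaluated once and before the tree
  goes on.\<close>

fun compile :: "tm \<Rightarrow> tm \<Rightarrow> dt \<Rightarrow> tm" where
  "compile P M (Ret m) = Num m"
| "compile P M Echo = M"
| "compile P M (IfEq c D D') = ifeq c M (compile P M D) (compile P M D')"
| "compile P M (Ask q D) = Con CByval \<^bold>\<cdot> Lam NatT (compile (lift 0 P) (Var 0) D) \<^bold>\<cdot> (P \<^bold>\<cdot> Num q)"

definition dtm :: "dt \<Rightarrow> tm" where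
  "dtm D = Lam (pure_ty 1) (compile (Var 0) (Num 0) D)"

lemma subst_ifeq: "subst k N (ifeq c M A B) = ifeq c (subst k N M) (subst k N A) (subst k N B)"
  by (induction c arbitrary: M) auto

lemma subst_compile: "subst k N (compile P M D) = compile (subst k N P) (subst k N M) D"
  by (induction D arbitrary: k N P M) (simp_all add: subst_ifeq subst_lift_comm)

lemma dtm_beta: "dtm D \<^bold>\<cdot> P \<leadsto> compile P (Num 0) D"
  using step.beta[of _ "compile (Var 0) (Num 0) D" P] by (simp add: dtm_def subst_compile)

lemma byval_compile_steps:
  "step\<^sup>*\<^sup>* (Con CByval \<^bold>\<cdot> Lam NatT (compile (lift 0 P) (Var 0) D) \<^bold>\<cdot> Num a) (compile P (Num a) D)"
  using step.beta[of NatT "compile (lift 0 P) (Var 0) D" "Num a"] step.byval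
  by (simp add: subst_compile) (meson converse_rtranclp_into_rtranclp r_into_rtranclp)

lemma ifzero_0_steps: "step\<^sup>*\<^sup>* (Con CIfzero \<^bold>\<cdot> Num 0 \<^bold>\<cdot> A \<^bold>\<cdot> B) A"
proof -
  have "Con CIfzero \<^bold>\<cdot> Num 0 \<^bold>\<cdot> A \<^bold>\<cdot> B \<leadsto> Lam NatT (Lam NatT (Var 1)) \<^bold>\<cdot> A \<^bold>\<cdot> B"
    using step.ifzero_0 by (intro step.ctx_app) simp
  moreover have "Lam NatT (Lam NatT (Var 1)) \<^bold>\<cdot> A \<^bold>\<cdot> B \<leadsto> Lam NatT (lift 0 A) \<^bold>\<cdot> B"
    using step.beta[of NatT "Lam NatT (Var 1)" A] by (intro step.ctx_app) simp
  moreover have "Lam NatT (lift 0 A) \<^bold>\<cdot> B \<leadsto> A"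
    using step.beta[of NatT "(lift 0 A)" B] by simp
  ultimately show ?thesis by (meson converse_rtranclp_into_rtranclp rtranclp.rtrancl_refl)
qed

lemma ifzero_Suc_steps: "step\<^sup>*\<^sup>* (Con CIfzero \<^bold>\<cdot> Num (Suc n) \<^bold>\<cdot> A \<^bold>\<cdot> B) B"
proof -
  have "Con CIfzero \<^bold>\<cdot> Num (Suc n) \<^bold>\<cdot> A \<^bold>\<cdot> B \<leadsto> Lam NatT (Lam NatT (Var 0)) \<^bold>\<cdot> A \<^bold>\<cdot> B"
    using step.ifzero_suc[of n] by (intro step.ctx_app) simp
  moreover have "Lam NatT (Lam NatT (Var 0)) \<^bold>\<cdot> A \<^bold>\<cdot> B \<leadsto> Lam NatT (Var 0) \<^bold>\<cdot> B"
    using step.beta[of NatT "Lam NatT (Var 0)" A] by (intro step.ctx_app) simp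
  moreover have "Lam NatT (Var 0) \<^bold>\<cdot> B \<leadsto> B"
    using step.beta[of NatT "(Var 0)" B] by simp
  ultimately show ?thesis by (meson converse_rtranclp_into_rtranclp rtranclp.rtrancl_refl)
qed

lemma ifzero_cond_steps:
  assumes "step\<^sup>*\<^sup>* M (Num a)"
  shows "step\<^sup>*\<^sup>* (Con CIfzero \<^bold>\<cdot> M \<^bold>\<cdot> A \<^bold>\<cdot> B) (if a = 0 then A else B)"
proof -
  have "ectx (\<lambda>X. Con CIfzero \<^bold>\<cdot> X \<^bold>\<cdot> A \<^bold>\<cdot> B)"
    using ectx_comp[OF ectx_comp[OF ectx_frames(1) ectx_frames(1)] ectx_frames(4)] .
  from ectx_steps[OF this assms]
  show ?thesis using ifzero_0_steps ifzero_Suc_steps by (cases a) (auto intro: rtranclp_trans)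
qed

lemma pre_steps:
  assumes "step\<^sup>*\<^sup>* M (Num a)"
  shows "step\<^sup>*\<^sup>* (Con CPre \<^bold>\<cdot> M) (Num (a - 1))"
proof -
  have "Con CPre \<^bold>\<cdot> Num a \<leadsto> Num (a - 1)"
    using step.pre_0 step.pre_suc[of "a - 1"] by (cases a) auto
  with ectx_steps[OF ectx_frames(3) assms] show ?thesis by simp
qed

lemma ifeq_steps: "step\<^sup>*\<^sup>* M (Num a) \<Longrightarrow> step\<^sup>*\<^sup>* (ifeq c M A B) (if a = c then A else B)"
proof (induction c arbitrary: M a)
  case 0
  then show ?case using ifzero_cond_steps[of M a A B] by simp
next
  case (Suc c)
  show ?case
  proof (cases "a = 0")
    case True
    then show ?thesis using ifzero_cond_steps[OF Suc.prems] by simp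
  next
    case False
    then have "step\<^sup>*\<^sup>* (ifeq (Suc c) M A B) (ifeq c (Con CPre \<^bold>\<cdot> M) A B)"
      using ifzero_cond_steps[OF Suc.prems, of B] by simp
    also have "step\<^sup>*\<^sup>* (ifeq c (Con CPre \<^bold>\<cdot> M) A B) (if a - 1 = c then A else B)"
      by (rule Suc.IH) (rule pre_steps[OF Suc.prems])
    finally show ?thesis using False by (cases a) auto
  qed
qed

lemma compile_run:
  "run (\<lambda>q. evaluates (P \<^bold>\<cdot> Num q)) D a k \<Longrightarrow> step\<^sup>*\<^sup>* (compile P (Num a) D) (Num k)"
proof (induction D arbitrary: a)
  case (IfEq c D D')
  then show ?case
    using ifeq_steps[of "Num a" a c "compile P (Num a) D" "compile P (Num a) D'"]
    by (auto split: if_splits intro: rtranclp_trans)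
next
  case (Ask q D)
  then obtain a' where a': "step\<^sup>*\<^sup>* (P \<^bold>\<cdot> Num q) (Num a')" "step\<^sup>*\<^sup>* (compile P (Num a') D) (Num k)"
    by (auto simp: evaluates_def)
  have "step\<^sup>*\<^sup>* (Con CByval \<^bold>\<cdot> B \<^bold>\<cdot> (P \<^bold>\<cdot> Num q)) (Con CByval \<^bold>\<cdot> B \<^bold>\<cdot> Num a')" for B
    using a'(1) by (rule steps_ctx) (rule step.ctx_byval)
  with byval_compile_steps[of P D a'] a'(2) show ?case by (auto intro: rtranclp_trans)
qed auto

lemma dtm_run:
  "run (\<lambda>q. evaluates (P \<^bold>\<cdot> Num q)) D 0 k \<Longrightarrow> step\<^sup>*\<^sup>* (dtm D \<^bold>\<cdot> P) (Num k)"
  using dtm_beta compile_run by (meson converse_rtranclp_into_rtranclp)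

lemma run_mono:
  "run Q D a k \<Longrightarrow> (\<And>q a. Q q a \<Longrightarrow> Q' q a) \<Longrightarrow> run Q' D a k"
  by (induction D arbitrary: a) (auto split: if_splits)

lemma compile_inv:
  assumes "ectx E" and "(step ^^ n) (E (compile P (Num a) D)) (Num v)"
  shows "\<exists>k. run (\<lambda>q a. \<exists>m\<le>n. (step ^^ m) (P \<^bold>\<cdot> Num q) (Num a)) D a k \<and>
    (\<exists>n'\<le>n. (step ^^ n') (E (Num k)) (Num v))"
  using assms(2)
proof (induction D arbitrary: a n)
  case (IfEq c D D')
  let ?D = "if a = c then D else D'"
  have "step\<^sup>*\<^sup>* (E (compile P (Num a) (IfEq c D D'))) (E (compile P (Num a) ?D))"
    using ectx_steps[OF assms(1) ifeq_steps[of "Num a" a c "compile P (Num a) D" "compile P (Num a) D'"]]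
    by (cases "a = c") simp_all
  from steps_strip[OF this IfEq.prems] obtain n' where
    n': "n' \<le> n" "(step ^^ n') (E (compile P (Num a) ?D)) (Num v)" by blast
  then obtain k where k: "run (\<lambda>q a. \<exists>m\<le>n'. (step ^^ m) (P \<^bold>\<cdot> Num q) (Num a)) ?D a k"
    and "\<exists>n''\<le>n'. (step ^^ n'') (E (Num k)) (Num v)"
    using IfEq.IH by (cases "a = c") force+
  moreover have "run (\<lambda>q a. \<exists>m\<le>n. (step ^^ m) (P \<^bold>\<cdot> Num q) (Num a)) ?D a k"
    using k by (rule run_mono) (use n'(1) in \<open>meson le_trans\<close>)
  ultimately show ?case using n'(1) by (auto split: if_splits intro: le_trans)
next
  case (Ask q D)
  from byval_split[OF assms(1)] Ask.prems obtain a' m n' where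
    a': "(step ^^ m) (P \<^bold>\<cdot> Num q) (Num a')" "m + n' = n"
      "(step ^^ n') (E (Con CByval \<^bold>\<cdot> Lam NatT (compile (lift 0 P) (Var 0) D) \<^bold>\<cdot> Num a')) (Num v)"
    by fastforce
  from steps_strip[OF ectx_steps[OF assms(1) byval_compile_steps] a'(3)] obtain n'' where
    n'': "n'' \<le> n'" "(step ^^ n'') (E (compile P (Num a') D)) (Num v)" by blast
  from Ask.IH[OF n''(2)] obtain k where
    k: "run (\<lambda>q a. \<exists>m\<le>n''. (step ^^ m) (P \<^bold>\<cdot> Num q) (Num a)) D a' k"
    and kn: "\<exists>n'\<le>n''. (step ^^ n') (E (Num k)) (Num v)" by blast
  have le: "n'' \<le> n" "m \<le> n" using n''(1) a'(2) by auto
  have "run (\<lambda>q a. \<exists>m\<le>n. (step ^^ m) (P \<^bold>\<cdot> Num q) (Num a)) D a' k"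
    using k by (rule run_mono) (use le in \<open>meson le_trans\<close>)
  with a'(1) le kn show ?case by (auto intro: le_trans)
qed auto

lemma dtm_inv:
  assumes "ectx E" and "(step ^^ n) (E (dtm D \<^bold>\<cdot> P)) (Num v)"
  shows "\<exists>k. run (\<lambda>q a. \<exists>m<n. (step ^^ m) (P \<^bold>\<cdot> Num q) (Num a)) D 0 k \<and>
    (\<exists>n'<n. (step ^^ n') (E (Num k)) (Num v))"
proof -
  have st: "E (dtm D \<^bold>\<cdot> P) \<leadsto> E (compile P (Num 0) D)"
    using assms(1) dtm_beta by (simp add: ectx_def)
  then have "n \<noteq> 0" using assms(2) by (intro notI) simp
  then obtain n0 where n0: "n = Suc n0" by (cases n) auto
  with assms(2) st step_det have "(step ^^ n0) (E (compile P (Num 0) D)) (Num v)"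
    by (metis relpowp_Suc_D2)
  from compile_inv[OF assms(1) this] show ?thesis by (simp add: n0 less_Suc_eq_le)
qed

lemma typed_Var_same: "i < length \<Gamma> \<Longrightarrow> \<Gamma> ! i = \<sigma> \<Longrightarrow> typed \<Gamma> (Var i) \<sigma>"
  using typed.Var by blast

lemma typed_Con_same: "const_ty c = \<sigma> \<Longrightarrow> typed \<Gamma> (Con c) \<sigma>"
  using typed.Con by blast

lemma typed_ifeq:
  assumes "typed \<Gamma> A NatT" "typed \<Gamma> B NatT"
  shows "typed \<Gamma> M NatT \<Longrightarrow> typed \<Gamma> (ifeq c M A B) NatT"
proof (induction c arbitrary: M)
  case 0
  then show ?case using assms typed.Con[of \<Gamma> CIfzero] by (auto intro: typed.App)
next
  case (Suc c)
  have "typed \<Gamma> (Con CPre \<^bold>\<cdot> M) NatT"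
    using Suc.prems typed.Con[of \<Gamma> CPre] by (auto intro: typed.App)
  from Suc.IH[OF this] show ?case
    using Suc.prems assms typed.Con[of \<Gamma> CIfzero] by (auto intro: typed.App)
qed

lemma typed_compile:
  "i < length \<Gamma> \<Longrightarrow> \<Gamma> ! i = pure_ty 1 \<Longrightarrow> typed \<Gamma> M NatT \<Longrightarrow> typed \<Gamma> (compile (Var i) M D) NatT"
proof (induction D arbitrary: i \<Gamma> M)
  case (Ret m)
  then show ?case by (simp add: typed_Con_same)
next
  case (Ask q D)
  have "typed (NatT # \<Gamma>) (compile (Var (Suc i)) (Var 0) D) NatT"
    using Ask.prems by (intro Ask.IH typed_Var_same) simp_all
  then have "typed \<Gamma> (Lam NatT (compile (lift 0 (Var i)) (Var 0) D)) (NatT \<^bold>\<rightarrow> NatT)"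
    by (simp add: typed.Lam)
  moreover have "typed \<Gamma> (Var i \<^bold>\<cdot> Num q) NatT"
    using Ask.prems by (intro typed.App[of _ _ NatT] typed_Var_same typed_Con_same) simp_all
  moreover have "typed \<Gamma> (Con CByval) ((NatT \<^bold>\<rightarrow> NatT) \<^bold>\<rightarrow> NatT \<^bold>\<rightarrow> NatT)"
    by (simp add: typed_Con_same)
  ultimately show ?case by (auto intro: typed.App)
qed (simp_all add: typed_ifeq)

lemma constants_ifeq:
  "constants_of (ifeq c M A B) \<subseteq>
    {CIfzero, CPre} \<union> constants_of M \<union> constants_of A \<union> constants_of B"
  by (induction c arbitrary: M) fastforce+

lemma constants_compile:
  "constants_of M \<subseteq> T0_str \<Longrightarrow> constants_of (compile (Var i) M D) \<subseteq> T0_str"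
proof (induction D arbitrary: i M)
  case (IfEq c D D')
  have "constants_of (compile (Var i) M (IfEq c D D')) \<subseteq> {CIfzero, CPre} \<union> constants_of M \<union>
      constants_of (compile (Var i) M D) \<union> constants_of (compile (Var i) M D')"
    unfolding compile.simps by (rule constants_ifeq)
  also have "\<dots> \<subseteq> T0_str"
    using IfEq by (auto simp: T0_str_def base_consts_def)
  finally show ?case .
qed (auto simp: T0_str_def base_consts_def)

lemma closed_term_dtm: "closed_term T0_str (dtm D) (pure_ty 2)"
proof -
  have "typed [] (dtm D) (pure_ty 1 \<^bold>\<rightarrow> NatT)"
    unfolding dtm_def by (intro typed.Lam typed_compile typed_Con_same) simp_all
  then have "typed [] (dtm D) (pure_ty 2)" by (simp add: numeral_2_eq_2)
  moreover have "constants_of (dtm D) \<subseteq> T0_str"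
    using constants_compile[of "Num 0"] by (simp add: dtm_def T0_str_def base_consts_def)
  ultimately show ?thesis by (simp add: closed_term_def)
qed

section \<open>Evaluation with oracles\<close>

text \<open>The constants \<open>CRecstr\<close> and \<open>CByval\<close>, which do not occur in \<open>T_min\<close> terms, are reused as
  oracles of type 2, standing for \<open>F\<close> and \<open>G\<close>. In \<open>ostep k M q M'\<close> the label \<open>q\<close> is the oracle
  call made by the step, if any, and \<open>k\<close> is the answer to it.\<close>

definition oracles :: "const set" where
  "oracles = {CRecstr, CByval}"

inductive ostep :: "nat \<Rightarrow> tm \<Rightarrow> (const \<times> tm) option \<Rightarrow> tm \<Rightarrow> bool" for k where
  call: "c \<in> oracles \<Longrightarrow> ostep k (Con c \<^bold>\<cdot> P) (Some (c, P)) (Num k)"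
| beta: "ostep k (Lam \<sigma> M \<^bold>\<cdot> N) None (subst 0 N M)"
| suc: "ostep k (Con CSuc \<^bold>\<cdot> Num n) None (Num (n + 1))"
| pre: "ostep k (Con CPre \<^bold>\<cdot> Num n) None (Num (n - 1))"
| ifzero_0: "ostep k (Con CIfzero \<^bold>\<cdot> Num 0) None (Lam NatT (Lam NatT (Var 1)))"
| ifzero_suc: "ostep k (Con CIfzero \<^bold>\<cdot> Num (n + 1)) None (Lam NatT (Lam NatT (Var 0)))"
| rec_0: "ostep k (Con (CRec \<sigma>) \<^bold>\<cdot> X \<^bold>\<cdot> F \<^bold>\<cdot> Num 0) None X"
| rec_suc: "ostep k (Con (CRec \<sigma>) \<^bold>\<cdot> X \<^bold>\<cdot> F \<^bold>\<cdot> Num (n + 1)) None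
    (F \<^bold>\<cdot> (Con (CRec \<sigma>) \<^bold>\<cdot> X \<^bold>\<cdot> F \<^bold>\<cdot> Num n) \<^bold>\<cdot> Num n)"
| min: "ostep k (Con CMin \<^bold>\<cdot> F \<^bold>\<cdot> Num n) None
    (Con CIfzero \<^bold>\<cdot> (F \<^bold>\<cdot> Num n) \<^bold>\<cdot> Num n \<^bold>\<cdot> (Con CMin \<^bold>\<cdot> F \<^bold>\<cdot> (Con CSuc \<^bold>\<cdot> Num n)))"
| ctx_app: "ostep k M q M' \<Longrightarrow> ostep k (M \<^bold>\<cdot> N) q (M' \<^bold>\<cdot> N)"
| ctx_suc: "ostep k M q M' \<Longrightarrow> ostep k (Con CSuc \<^bold>\<cdot> M) q (Con CSuc \<^bold>\<cdot> M')"
| ctx_pre: "ostep k M q M' \<Longrightarrow> ostep k (Con CPre \<^bold>\<cdot> M) q (Con CPre \<^bold>\<cdot> M')"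
| ctx_ifzero: "ostep k M q M' \<Longrightarrow> ostep k (Con CIfzero \<^bold>\<cdot> M) q (Con CIfzero \<^bold>\<cdot> M')"
| ctx_rec: "ostep k M q M' \<Longrightarrow>
    ostep k (Con (CRec \<sigma>) \<^bold>\<cdot> X \<^bold>\<cdot> F \<^bold>\<cdot> M) q (Con (CRec \<sigma>) \<^bold>\<cdot> X \<^bold>\<cdot> F \<^bold>\<cdot> M')"
| ctx_min: "ostep k M q M' \<Longrightarrow> ostep k (Con CMin \<^bold>\<cdot> F \<^bold>\<cdot> M) q (Con CMin \<^bold>\<cdot> F \<^bold>\<cdot> M')"

lemma no_ostep_Con [simp]: "\<not> ostep k (Con c) q M"
  and no_ostep_Lam [simp]: "\<not> ostep k (Lam \<sigma> N) q M"
  by (auto elim: ostep.cases)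

lemma no_ostep_Con1 [simp]: "\<not> ostep k (Con (CRec \<sigma>) \<^bold>\<cdot> X) q M" "\<not> ostep k (Con CMin \<^bold>\<cdot> X) q M"
  by (auto elim: ostep.cases simp: oracles_def)

lemma no_ostep_Con2 [simp]: "\<not> ostep k (Con (CRec \<sigma>) \<^bold>\<cdot> X \<^bold>\<cdot> Y) q M"
  by (auto elim: ostep.cases)

lemma ostep_det: "ostep k M q1 M1 \<Longrightarrow> ostep k M q2 M2 \<Longrightarrow> q1 = q2 \<and> M1 = M2"
proof (induction arbitrary: q2 M2 rule: ostep.induct)
  case (call c P)
  from call.prems call.hyps show ?case by cases (auto simp: oracles_def)
next
  case (ctx_app M q M')
  from ctx_app.prems show ?case
    by cases (use ctx_app.hyps in \<open>auto dest: ctx_app.IH\<close>)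
next
  case (ctx_suc M q M')
  from ctx_suc.prems show ?case
    by cases (use ctx_suc.hyps in \<open>auto dest: ctx_suc.IH simp: oracles_def\<close>)
next
  case (ctx_pre M q M')
  from ctx_pre.prems show ?case
    by cases (use ctx_pre.hyps in \<open>auto dest: ctx_pre.IH simp: oracles_def\<close>)
next
  case (ctx_ifzero M q M')
  from ctx_ifzero.prems show ?case
    by cases (use ctx_ifzero.hyps in \<open>auto dest: ctx_ifzero.IH simp: oracles_def\<close>)
next
  case (ctx_rec M q M')
  from ctx_rec.prems show ?case
    by cases (use ctx_rec.hyps in \<open>auto dest: ctx_rec.IH\<close>)
next
  case (ctx_min M q M')
  from ctx_min.prems show ?case
    by cases (use ctx_min.hyps in \<open>auto dest: ctx_min.IH\<close>)
qed (erule ostep.cases; simp add: oracles_def)+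

lemma ostep_answer: "ostep k M q M' \<Longrightarrow> \<exists>M''. ostep k' M q M''"
  by (induction rule: ostep.induct) (blast intro: ostep.intros)+

lemma ostep_pure: "ostep k M q M' \<Longrightarrow> q = None \<Longrightarrow> ostep k' M q M'"
  by (induction rule: ostep.induct) (blast intro: ostep.intros | simp)+

lemma ostep_None_det: "ostep k M None M' \<Longrightarrow> ostep k' M q M'' \<Longrightarrow> q = None \<and> M'' = M'"
  using ostep_pure[of k M None M' k'] ostep_det by blast

lemma ostep_label_det: "ostep k M q M' \<Longrightarrow> ostep k' M q' M'' \<Longrightarrow> q' = q"
  using ostep_answer[of k M q M' k'] ostep_det by blast

section \<open>The nesting of oracle calls\<close>

abbreviation reach :: "tm \<Rightarrow> tm \<Rightarrow> bool" where
  "reach \<equiv> (\<lambda>M M'. \<exists>k q. ostep k M q M')\<^sup>*\<^sup>*"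

text \<open>A child of \<open>M\<close> is a query to the argument of an oracle call that \<open>M\<close> makes for some
  answers to its earlier calls.\<close>

definition child :: "tm \<Rightarrow> tm \<Rightarrow> bool" where
  "child M N \<longleftrightarrow> (\<exists>M' k c P M'' n. reach M M' \<and> ostep k M' (Some (c, P)) M'' \<and> N = P \<^bold>\<cdot> Num n)"

text \<open>Progress under all answers. Were \<open>M\<close> to stop at a term that is no numeral,
  such as an abstraction, \<open>E M\<close> could take steps that come neither from
  \<open>M\<close> nor from some \<open>E (Num n)\<close>, and \<open>reach_octx\<close> would
  fail.\<close>

definition safe :: "tm \<Rightarrow> bool" where
  "safe M \<longleftrightarrow> (\<forall>M'. reach M M' \<longrightarrow> (\<exists>n. M' = Num n) \<or> (\<exists>k q M''. ostep k M' q M''))"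

text \<open>The safe terms in the well-founded part of \<open>child\<close>; its induction rule is
  the induction on nesting. Nothing is said about termination of the run of \<open>M\<close> itself,
  which leaves room for \<open>min\<close>.\<close>

inductive good :: "tm \<Rightarrow> bool" where
  "(\<And>N. child M N \<Longrightarrow> good N) \<Longrightarrow> safe M \<Longrightarrow> good M"

lemma good_safe: "good M \<Longrightarrow> safe M"
  and good_child: "good M \<Longrightarrow> child M N \<Longrightarrow> good N"
  by (auto elim: good.cases)

lemma reach_step: "ostep k M q M' \<Longrightarrow> reach M' X \<Longrightarrow> reach M X"
  by (rule converse_rtranclp_into_rtranclp[rotated]) auto

lemma reach_last: "reach M X \<Longrightarrow> ostep k X q Y \<Longrightarrow> reach M Y"
  by (rule rtranclp.rtrancl_into_rtrancl) auto

lemma reach_Num [simp]: "reach (Num n) X \<longleftrightarrow> X = Num n"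
  by (auto elim: converse_rtranclpE)

lemma good_Num: "good (Num n)"
  by (rule good.intros) (auto simp: child_def safe_def)

text \<open>A step without a call adds no children. A step with a call would add all queries to the
  argument of the call.\<close>

lemma good_expand:
  assumes "ostep k M None M'" and "good M'"
  shows "good M"
proof -
  have reach: "X = M \<or> reach M' X" if "reach M X" for X
    using that by (cases rule: converse_rtranclpE) (auto dest: ostep_None_det[OF assms(1)])
  show ?thesis
  proof (rule good.intros)
    fix N assume "child M N"
    then obtain M1 k' c P M2 n where
      N: "reach M M1" "ostep k' M1 (Some (c, P)) M2" "N = P \<^bold>\<cdot> Num n"
      by (auto simp: child_def)
    with reach ostep_None_det[OF assms(1)] have "reach M' M1" by blast
    with N have "child M' N" by (auto simp: child_def)
    with assms(2) show "good N" by (rule good_child)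
  next
    show "safe M"
      using reach assms good_safe[OF assms(2)] unfolding safe_def by blast
  qed
qed

definition octx :: "(tm \<Rightarrow> tm) \<Rightarrow> bool" where
  "octx E \<longleftrightarrow> (\<forall>k M q M'. ostep k M q M' \<longrightarrow> ostep k (E M) q (E M'))"

lemma octx_app: "octx E \<Longrightarrow> octx (\<lambda>X. E X \<^bold>\<cdot> N)"
  by (simp add: octx_def ostep.ctx_app)

lemma octx_frames:
  "octx (\<lambda>X. Con CSuc \<^bold>\<cdot> X)" "octx (\<lambda>X. Con CPre \<^bold>\<cdot> X)" "octx (\<lambda>X. Con CIfzero \<^bold>\<cdot> X)"
  "octx (\<lambda>X. Con (CRec \<sigma>) \<^bold>\<cdot> Y \<^bold>\<cdot> F \<^bold>\<cdot> X)" "octx (\<lambda>X. Con CMin \<^bold>\<cdot> F \<^bold>\<cdot> X)"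
  by (simp_all add: octx_def ostep.intros)

text \<open>While \<open>M\<close> runs, \<open>E\<close> only relays its steps; once
  \<open>M\<close> has become a numeral, the run is one of \<open>E (Num n)\<close>.\<close>

lemma reach_octx:
  assumes "octx E" and "safe M" and "reach (E M) X"
  shows "(\<exists>M'. reach M M' \<and> X = E M') \<or> (\<exists>n. reach M (Num n) \<and> reach (E (Num n)) X)"
  using assms(3)
proof (induction rule: rtranclp_induct)
  case base
  then show ?case by blast
next
  case (step Y Z)
  from step.hyps(2) obtain k q where st: "ostep k Y q Z" by blast
  from step.IH show ?case
  proof
    assume "\<exists>n. reach M (Num n) \<and> reach (E (Num n)) Y"
    with st reach_last show ?thesis by blast
  next
    assume "\<exists>M'. reach M M' \<and> Y = E M'"
    then obtain M' where M': "reach M M'" "Y = E M'" by blast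
    with assms(2) consider n where "M' = Num n" | k' q' M'' where "ostep k' M' q' M''"
      by (auto simp: safe_def)
    then show ?thesis
    proof cases
      case 1
      with M' step.hyps(2) show ?thesis by blast
    next
      case 2
      then obtain M2 where M2: "ostep k M' q' M2" using ostep_answer by blast
      with assms(1) have "ostep k Y q' (E M2)" by (simp add: octx_def M'(2))
      with st have "Z = E M2" using ostep_det by blast
      moreover have "reach M M2" using M'(1) M2 by (rule reach_last)
      ultimately show ?thesis by blast
    qed
  qed
qed

text \<open>A context acts after its hole, not around it: each child of \<open>E M\<close> is a
  child of \<open>M\<close> or of some \<open>E (Num n)\<close>. Sequencing lengthens a computation
  without deepening its nesting.\<close>

lemma good_octx:
  assumes "octx E" and "good M" and Num: "\<And>n. good (E (Num n))"
  shows "good (E M)"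
proof (rule good.intros)
  note split = reach_octx[OF assms(1) good_safe[OF assms(2)]]
  have step_E: "\<exists>n. M' = Num n" if "reach M M'" "\<nexists>q M''. ostep k M' q M''" for M' k
    using that good_safe[OF assms(2)] unfolding safe_def by (meson ostep_answer)
  fix N assume "child (E M) N"
  then obtain X k c P X' n where
    N: "reach (E M) X" "ostep k X (Some (c, P)) X'" "N = P \<^bold>\<cdot> Num n"
    by (auto simp: child_def)
  from split[OF N(1)] consider M' q M'' where "reach M M'" "X = E M'" "ostep k M' q M''"
    | m where "reach (E (Num m)) X"
    using step_E by blast
  then show "good N"
  proof cases
    case 1
    with assms(1) have "ostep k X q (E M'')" by (simp add: octx_def)
    with N(2) have "q = Some (c, P)" using ostep_det by blast
    with 1 N(3) have "child M N" by (auto simp: child_def)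
    with assms(2) show ?thesis by (rule good_child)
  next
    case 2
    with N have "child (E (Num m)) N" by (auto simp: child_def)
    with Num show ?thesis by (rule good_child)
  qed
next
  show "safe (E M)"
    unfolding safe_def
  proof (intro allI impI)
    fix X assume "reach (E M) X"
    from reach_octx[OF assms(1) good_safe[OF assms(2)] this]
    consider M' where "reach M M'" "X = E M'" | n where "reach (E (Num n)) X" by blast
    then show "(\<exists>n. X = Num n) \<or> (\<exists>k q X'. ostep k X q X')"
    proof cases
      case 1
      with good_safe[OF assms(2)] consider n where "M' = Num n" | k q M'' where "ostep k M' q M''"
        by (auto simp: safe_def)
      then show ?thesis
      proof cases
        case (1 n)
        with good_safe[OF Num[of n]] \<open>X = E M'\<close> show ?thesis by (auto simp: safe_def)
      next
        case (2 k q M'')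
        with assms(1) have "ostep k X q (E M'')" using \<open>X = E M'\<close> by (simp add: octx_def)
        then show ?thesis by blast
      qed
    next
      case (2 n)
      with good_safe[OF Num[of n]] show ?thesis by (auto simp: safe_def)
    qed
  qed
qed

section \<open>Reducibility\<close>

text \<open>A Tait-style logical relation with \<open>good\<close> at the base in place of
  termination. Arguments are closed, so that they can be substituted under binders without
  lifting.\<close>

fun Red :: "ty \<Rightarrow> tm \<Rightarrow> bool" where
  "Red NatT M \<longleftrightarrow> good M"
| "Red (\<sigma> \<^bold>\<rightarrow> \<tau>) M \<longleftrightarrow> (\<forall>N. cl 0 N \<longrightarrow> Red \<sigma> N \<longrightarrow> Red \<tau> (M \<^bold>\<cdot> N))"

lemma Red_expand: "ostep k M None M' \<Longrightarrow> Red \<sigma> M' \<Longrightarrow> Red \<sigma> M"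
proof (induction \<sigma> arbitrary: M M')
  case NatT
  then show ?case by (auto intro: good_expand)
next
  case (Arr \<sigma> \<tau>)
  then show ?case using ostep.ctx_app by simp blast
qed

lemma Red_octx: "octx E \<Longrightarrow> good M \<Longrightarrow> (\<And>n. Red \<sigma> (E (Num n))) \<Longrightarrow> Red \<sigma> (E M)"
proof (induction \<sigma> arbitrary: E)
  case NatT
  then show ?case by (auto intro: good_octx)
next
  case (Arr \<sigma> \<tau>)
  show ?case
    using Arr.IH(2)[OF octx_app[OF Arr.prems(1)] Arr.prems(2)] Arr.prems(3) by simp
qed

lemma ifzero_0_osteps:
  obtains M1 M2 where "ostep k (Con CIfzero \<^bold>\<cdot> Num 0 \<^bold>\<cdot> A \<^bold>\<cdot> B) None M1" "ostep k M1 None M2"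
    "ostep k M2 None A"
proof
  show "ostep k (Con CIfzero \<^bold>\<cdot> Num 0 \<^bold>\<cdot> A \<^bold>\<cdot> B) None (Lam NatT (Lam NatT (Var 1)) \<^bold>\<cdot> A \<^bold>\<cdot> B)"
    by (intro ostep.ctx_app ostep.ifzero_0)
  show "ostep k (Lam NatT (Lam NatT (Var 1)) \<^bold>\<cdot> A \<^bold>\<cdot> B) None (Lam NatT (lift 0 A) \<^bold>\<cdot> B)"
    using ostep.beta[of k NatT "Lam NatT (Var 1)" A] by (intro ostep.ctx_app) simp
  show "ostep k (Lam NatT (lift 0 A) \<^bold>\<cdot> B) None A"
    using ostep.beta[of k NatT "lift 0 A" B] by simp
qed

lemma ifzero_Suc_osteps:
  obtains M1 M2 where "ostep k (Con CIfzero \<^bold>\<cdot> Num (Suc n) \<^bold>\<cdot> A \<^bold>\<cdot> B) None M1"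
    "ostep k M1 None M2" "ostep k M2 None B"
proof
  show "ostep k (Con CIfzero \<^bold>\<cdot> Num (Suc n) \<^bold>\<cdot> A \<^bold>\<cdot> B) None
      (Lam NatT (Lam NatT (Var 0)) \<^bold>\<cdot> A \<^bold>\<cdot> B)"
    using ostep.ifzero_suc[of k n] by (intro ostep.ctx_app) simp
  show "ostep k (Lam NatT (Lam NatT (Var 0)) \<^bold>\<cdot> A \<^bold>\<cdot> B) None (Lam NatT (Var 0) \<^bold>\<cdot> B)"
    using ostep.beta[of k NatT "Lam NatT (Var 0)" A] by (intro ostep.ctx_app) simp
  show "ostep k (Lam NatT (Var 0) \<^bold>\<cdot> B) None B"
    using ostep.beta[of k NatT "Var 0" B] by simp
qed

lemma good_ifzero:
  assumes "good M" "good A" "good B"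
  shows "good (Con CIfzero \<^bold>\<cdot> M \<^bold>\<cdot> A \<^bold>\<cdot> B)"
proof (rule good_octx[of "\<lambda>X. Con CIfzero \<^bold>\<cdot> X \<^bold>\<cdot> A \<^bold>\<cdot> B", OF _ assms(1)])
  show "octx (\<lambda>X. Con CIfzero \<^bold>\<cdot> X \<^bold>\<cdot> A \<^bold>\<cdot> B)"
    by (intro octx_app octx_frames)
  show "good (Con CIfzero \<^bold>\<cdot> Num n \<^bold>\<cdot> A \<^bold>\<cdot> B)" for n
    using assms(2,3) by (cases n; metis good_expand ifzero_0_osteps ifzero_Suc_osteps)
qed

text \<open>Minimization unwinds without end but never nests: every oracle call made by
  \<open>min F m\<close> is made by some \<open>F m'\<close>.\<close>

lemma good_min_Num:
  assumes F: "\<And>m. good (F \<^bold>\<cdot> Num m)"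
  shows "good (Con CMin \<^bold>\<cdot> F \<^bold>\<cdot> Num m)"
proof -
  define pure where "pure = (\<lambda>M M'. ostep 0 M None M')"
  define W where "W Y \<longleftrightarrow> (\<exists>m. pure\<^sup>*\<^sup>* Y (Con CMin \<^bold>\<cdot> F \<^bold>\<cdot> Num m) \<or> pure\<^sup>*\<^sup>* Y (Num m))" for Y
  define E where
    "E m X = Con CIfzero \<^bold>\<cdot> X \<^bold>\<cdot> Num m \<^bold>\<cdot> (Con CMin \<^bold>\<cdot> F \<^bold>\<cdot> (Con CSuc \<^bold>\<cdot> Num m))" for m X
  define I where "I Y \<longleftrightarrow> W Y \<or> (\<exists>m Y0. reach (F \<^bold>\<cdot> Num m) Y0 \<and> Y = E m Y0)" for Y
  have octx_E: "octx (E m)" for m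
    unfolding E_def by (intro octx_app octx_frames)
  have W_E: "W (E m (Num n))" for m n
  proof (cases n)
    case 0
    obtain M1 M2 where "pure (E m (Num n)) M1" "pure M1 M2" "pure M2 (Num m)"
      unfolding pure_def E_def 0 by (rule ifzero_0_osteps)
    then have "pure\<^sup>*\<^sup>* (E m (Num n)) (Num m)" by (meson converse_rtranclp_into_rtranclp rtranclp.rtrancl_refl)
    then show ?thesis unfolding W_def by blast
  next
    case (Suc n')
    obtain M1 M2 where "pure (E m (Num n)) M1" "pure M1 M2"
      "pure M2 (Con CMin \<^bold>\<cdot> F \<^bold>\<cdot> (Con CSuc \<^bold>\<cdot> Num m))"
      unfolding pure_def E_def Suc by (rule ifzero_Suc_osteps)
    moreover have "pure (Con CMin \<^bold>\<cdot> F \<^bold>\<cdot> (Con CSuc \<^bold>\<cdot> Num m)) (Con CMin \<^bold>\<cdot> F \<^bold>\<cdot> Num (m + 1))"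
      unfolding pure_def by (intro ostep.ctx_min ostep.suc)
    ultimately have "pure\<^sup>*\<^sup>* (E m (Num n)) (Con CMin \<^bold>\<cdot> F \<^bold>\<cdot> Num (m + 1))"
      by (meson converse_rtranclp_into_rtranclp rtranclp.rtrancl_refl)
    then show ?thesis unfolding W_def by blast
  qed
  have W_pure: "(\<exists>n. Y = Num n) \<or> (\<exists>Y'. ostep 0 Y None Y' \<and> I Y')" if "W Y" for Y
  proof -
    from that obtain m where "pure\<^sup>*\<^sup>* Y (Con CMin \<^bold>\<cdot> F \<^bold>\<cdot> Num m) \<or> pure\<^sup>*\<^sup>* Y (Num m)"
      unfolding W_def by blast
    then show ?thesis
    proof
      assume "pure\<^sup>*\<^sup>* Y (Con CMin \<^bold>\<cdot> F \<^bold>\<cdot> Num m)"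
      then show ?thesis
      proof (cases rule: converse_rtranclpE)
        case base
        then have "ostep 0 Y None (E m (F \<^bold>\<cdot> Num m))"
          unfolding E_def by (simp only: ostep.min)
        moreover have "I (E m (F \<^bold>\<cdot> Num m))" unfolding I_def by blast
        ultimately show ?thesis by blast
      next
        case (step Z)
        then have "W Z" "ostep 0 Y None Z" unfolding W_def pure_def by blast+
        then show ?thesis unfolding I_def by blast
      qed
    next
      assume "pure\<^sup>*\<^sup>* Y (Num m)"
      then show ?thesis
      proof (cases rule: converse_rtranclpE)
        case (step Z)
        then have "W Z" "ostep 0 Y None Z" unfolding W_def pure_def by blast+
        then show ?thesis unfolding I_def by blast
      qed blast
    qed
  qed
  have I_cases: "(\<exists>n. Y = Num n) \<or> (\<exists>Y'. ostep 0 Y None Y' \<and> I Y') \<or>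
      (\<exists>m Y0 k q Y1. reach (F \<^bold>\<cdot> Num m) Y0 \<and> Y = E m Y0 \<and> ostep k Y0 q Y1)" if "I Y" for Y
  proof (cases "W Y")
    case True
    from W_pure[OF this] show ?thesis by blast
  next
    case False
    with that obtain m Y0 where Y0: "reach (F \<^bold>\<cdot> Num m) Y0" "Y = E m Y0" unfolding I_def by blast
    with good_safe[OF F[of m]] False W_E show ?thesis unfolding safe_def by blast
  qed
  have I_step: "I Y'" if "I Y" "ostep k Y q Y'" for Y k q Y'
    using I_cases[OF that(1)]
  proof (elim disjE exE conjE)
    fix n assume "Y = Num n"
    with that(2) show ?thesis by simp
  next
    fix Z assume "ostep 0 Y None Z" "I Z"
    with that(2) show ?thesis using ostep_None_det by blast
  next
    fix m Y0 k' q' Y1 assume *: "reach (F \<^bold>\<cdot> Num m) Y0" "Y = E m Y0" "ostep k' Y0 q' Y1"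
    then obtain Y2 where Y2: "ostep k Y0 q' Y2" using ostep_answer by blast
    with octx_E *(2) have "ostep k Y q' (E m Y2)" by (simp add: octx_def)
    with that(2) have "Y' = E m Y2" using ostep_det by blast
    moreover have "reach (F \<^bold>\<cdot> Num m) Y2" using *(1) Y2 by (rule reach_last)
    ultimately show ?thesis unfolding I_def by blast
  qed
  have I_reach: "I X" if "reach (Con CMin \<^bold>\<cdot> F \<^bold>\<cdot> Num m) X" for X
    using that
  proof (induction rule: rtranclp_induct)
    case base
    show ?case unfolding I_def W_def by blast
  next
    case (step Y Z)
    then show ?case using I_step by blast
  qed
  show ?thesis
  proof (rule good.intros)
    fix N assume "child (Con CMin \<^bold>\<cdot> F \<^bold>\<cdot> Num m) N"
    then obtain X k c P X' n where
      N: "reach (Con CMin \<^bold>\<cdot> F \<^bold>\<cdot> Num m) X" "ostep k X (Some (c, P)) X'" "N = P \<^bold>\<cdot> Num n"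
      by (auto simp: child_def)
    from I_cases[OF I_reach[OF N(1)]] show "good N"
    proof (elim disjE exE conjE)
      fix n assume "X = Num n"
      with N(2) show ?thesis by simp
    next
      fix Z assume "ostep 0 X None Z"
      with N(2) show ?thesis using ostep_None_det by blast
    next
      fix m Y0 k' q' Y1 assume *: "reach (F \<^bold>\<cdot> Num m) Y0" "X = E m Y0" "ostep k' Y0 q' Y1"
      with octx_E have "ostep k' X q' (E m Y1)" by (simp add: octx_def)
      with N(2) have "q' = Some (c, P)" using ostep_label_det by blast
      with * N(3) have "child (F \<^bold>\<cdot> Num m) N" by (auto simp: child_def)
      with F show ?thesis by (rule good_child)
    qed
  next
    have "(\<exists>n. X = Num n) \<or> (\<exists>k q X'. ostep k X q X')" if "I X" for X
      using I_cases[OF that]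
    proof (elim disjE exE conjE)
      fix m Y0 k' q' Y1 assume "X = E m Y0" "ostep k' Y0 q' Y1"
      with octx_E have "ostep k' X q' (E m Y1)" by (simp add: octx_def)
      then show ?thesis by blast
    qed blast+
    with I_reach show "safe (Con CMin \<^bold>\<cdot> F \<^bold>\<cdot> Num m)" unfolding safe_def by blast
  qed
qed

lemma Red_rec_Num:
  assumes "cl 0 X" "Red \<sigma> X" "cl 0 F" "Red (\<sigma> \<^bold>\<rightarrow> NatT \<^bold>\<rightarrow> \<sigma>) F"
  shows "Red \<sigma> (Con (CRec \<sigma>) \<^bold>\<cdot> X \<^bold>\<cdot> F \<^bold>\<cdot> Num n)"
proof (induction n)
  case 0
  show ?case using assms(2) by (rule Red_expand[OF ostep.rec_0])
next
  case (Suc n)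
  have "Red \<sigma> (F \<^bold>\<cdot> (Con (CRec \<sigma>) \<^bold>\<cdot> X \<^bold>\<cdot> F \<^bold>\<cdot> Num n) \<^bold>\<cdot> Num n)"
    using assms Suc by (simp add: good_Num)
  from Red_expand[OF ostep.rec_suc this] show ?case by simp
qed

lemma Red_Con:
  assumes "c \<in> T_min"
  shows "Red (const_ty c) (Con c)"
proof -
  consider n where "c = CNum n" | "c = CSuc" | "c = CPre" | "c = CIfzero" | \<sigma> where "c = CRec \<sigma>"
    | "c = CMin"
    using assms by (auto simp: T_min_def base_consts_def)
  then show ?thesis
  proof cases
    case 2
    have "good (Con CSuc \<^bold>\<cdot> M)" if "good M" for M
      using octx_frames(1) that by (rule good_octx) (rule good_expand[OF ostep.suc good_Num])
    with 2 show ?thesis by simp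
  next
    case 3
    have "good (Con CPre \<^bold>\<cdot> M)" if "good M" for M
      using octx_frames(2) that by (rule good_octx) (rule good_expand[OF ostep.pre good_Num])
    with 3 show ?thesis by simp
  next
    case (5 \<sigma>)
    have "Red \<sigma> (Con (CRec \<sigma>) \<^bold>\<cdot> X \<^bold>\<cdot> F \<^bold>\<cdot> M)"
      if "cl 0 X" "Red \<sigma> X" "cl 0 F" "Red (\<sigma> \<^bold>\<rightarrow> NatT \<^bold>\<rightarrow> \<sigma>) F" "good M" for X F M
      using octx_frames(4) that(5) by (rule Red_octx) (rule Red_rec_Num[OF that(1-4)])
    with 5 show ?thesis by simp
  next
    case 6
    have "good (Con CMin \<^bold>\<cdot> F \<^bold>\<cdot> M)" if "\<And>m. good (F \<^bold>\<cdot> Num m)" "good M" for F M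
      using octx_frames(5) that(2) by (rule good_octx) (rule good_min_Num[OF that(1)])
    with 6 show ?thesis by (simp add: good_Num)
  qed (simp_all add: good_Num good_ifzero)
qed

text \<open>Simultaneous substitution of closed terms, which need no lifting under binders.\<close>

fun csub :: "nat \<Rightarrow> tm list \<Rightarrow> tm \<Rightarrow> tm" where
  "csub k Ns (Var i) = (if i < k then Var i else if i - k < length Ns then Ns ! (i - k) else Num 0)"
| "csub k Ns (Con c) = Con c"
| "csub k Ns (M \<^bold>\<cdot> N) = csub k Ns M \<^bold>\<cdot> csub k Ns N"
| "csub k Ns (Lam \<sigma> M) = Lam \<sigma> (csub (Suc k) Ns M)"

lemma cl_csub: "(\<forall>N\<in>set Ns. cl 0 N) \<Longrightarrow> cl k (csub k Ns M)"
  by (induction M arbitrary: k) (auto intro: cl_mono)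

lemma csub_Nil: "cl k M \<Longrightarrow> csub k [] M = M"
  by (induction k M rule: cl.induct) auto

lemma subst_csub:
  "(\<forall>N\<in>set Ns. cl 0 N) \<Longrightarrow> cl 0 N \<Longrightarrow> subst k N (csub (Suc k) Ns M) = csub k (N # Ns) M"
proof (induction M arbitrary: k)
  case (Var i)
  consider "i < k" | "i = k" | j where "i = Suc (k + j)"
    using less_imp_Suc_add by (metis linorder_neqE_nat)
  then show ?case using Var by cases (auto intro: subst_cl[of 0])
qed (auto simp: lift_cl)

text \<open>The fundamental lemma of the logical relation, by induction on typing.\<close>

lemma Red_csub:
  assumes "typed \<Gamma> M \<sigma>" and "constants_of M \<subseteq> T_min"
    and "list_all2 (\<lambda>\<tau> N. cl 0 N \<and> Red \<tau> N) \<Gamma> Ns"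
  shows "Red \<sigma> (csub 0 Ns M)"
  using assms
proof (induction arbitrary: Ns rule: typed.induct)
  case (Var i \<Gamma>)
  then show ?case by (simp add: list_all2_conv_all_nth)
next
  case (Con \<Gamma> c)
  then show ?case by (simp add: Red_Con)
next
  case (App \<Gamma> M \<sigma> \<tau> N)
  have "cl 0 (csub 0 Ns N)"
    using App.prems(2) by (intro cl_csub) (auto simp: list_all2_conv_all_nth in_set_conv_nth)
  with App show ?case by simp
next
  case (Lam \<sigma> \<Gamma> M \<tau>)
  have Ns: "\<forall>N\<in>set Ns. cl 0 N"
    using Lam.prems(2) by (auto simp: list_all2_conv_all_nth in_set_conv_nth)
  have "Red \<tau> (Lam \<sigma> (csub 1 Ns M) \<^bold>\<cdot> N)" if "cl 0 N" "Red \<sigma> N" for N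
  proof (rule Red_expand[OF ostep.beta])
    show "Red \<tau> (subst 0 N (csub 1 Ns M))"
      using Lam.IH[of "N # Ns"] Lam.prems that Ns by (simp add: subst_csub)
  qed
  then show ?case by simp
qed

lemma Red_closed_term: "closed_term T_min M \<sigma> \<Longrightarrow> Red \<sigma> M"
  using Red_csub[of "[]" M \<sigma> "[]"] csub_Nil[of 0 M] closed_term_cl by (auto simp: closed_term_def)

lemma Red_oracle:
  assumes "c \<in> oracles"
  shows "Red (pure_ty 2) (Con c)"
proof -
  have "good (Con c \<^bold>\<cdot> P)" if P: "\<And>n. good (P \<^bold>\<cdot> Num n)" for P
  proof -
    have st: "ostep k (Con c \<^bold>\<cdot> P) (Some (c, P)) (Num k)" for k
      using assms by (rule ostep.call)
    have reach: "X = Con c \<^bold>\<cdot> P \<or> (\<exists>n. X = Num n)" if "reach (Con c \<^bold>\<cdot> P) X" for X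
      using that
    proof (cases rule: converse_rtranclpE)
      case (step Y)
      then obtain k q where "ostep k (Con c \<^bold>\<cdot> P) q Y" by blast
      from ostep_det[OF this st] step(2) show ?thesis by simp
    qed simp
    show ?thesis
    proof (rule good.intros)
      fix N assume "child (Con c \<^bold>\<cdot> P) N"
      then obtain X k c' P' X' n where
        N: "reach (Con c \<^bold>\<cdot> P) X" "ostep k X (Some (c', P')) X'" "N = P' \<^bold>\<cdot> Num n"
        by (auto simp: child_def)
      from reach[OF N(1)] N(2) have X: "X = Con c \<^bold>\<cdot> P" by auto
      from ostep_det[OF N(2)[unfolded X] st] have "P' = P" by simp
      with N(3) P show "good N" by simp
    next
      show "safe (Con c \<^bold>\<cdot> P)" using reach st unfolding safe_def by blast
    qed
  qed
  then show ?thesis by (simp add: numeral_2_eq_2 good_Num)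
qed

section \<open>Interpreting the oracles\<close>

primrec inst :: "tm \<Rightarrow> tm \<Rightarrow> tm \<Rightarrow> tm" where
  "inst F G (Var i) = Var i"
| "inst F G (Con c) = (if c = CRecstr then F else if c = CByval then G else Con c)"
| "inst F G (M \<^bold>\<cdot> N) = inst F G M \<^bold>\<cdot> inst F G N"
| "inst F G (Lam \<sigma> M) = Lam \<sigma> (inst F G M)"

lemma inst_T_min: "constants_of M \<subseteq> T_min \<Longrightarrow> inst F G M = M"
  by (induction M) (auto simp: T_min_def base_consts_def)

lemma inst_lift: "cl 0 F \<Longrightarrow> cl 0 G \<Longrightarrow> inst F G (lift k M) = lift k (inst F G M)"
  by (induction M arbitrary: k) (auto simp: lift_cl)

lemma inst_subst:
  "cl 0 F \<Longrightarrow> cl 0 G \<Longrightarrow> inst F G (subst k N M) = subst k (inst F G N) (inst F G M)"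
  by (induction M arbitrary: k N) (auto simp: subst_cl inst_lift)

lemma inst_step:
  assumes "cl 0 F" "cl 0 G"
  shows "ostep k M q M' \<Longrightarrow> q = None \<Longrightarrow> inst F G M \<leadsto> inst F G M'"
proof (induction rule: ostep.induct)
  case (pre n)
  then show ?case using step.pre_0 step.pre_suc[of "n - 1"] by (cases n) auto
next
  case (suc n)
  then show ?case using step.suc[of n] by simp
next
  case ifzero_0
  then show ?case using step.ifzero_0 by simp
next
  case (ifzero_suc n)
  then show ?case using step.ifzero_suc[of n] by simp
next
  case (rec_suc \<sigma> X F n)
  then show ?case using step.rec_suc[of _ _ _ n] by simp
qed (simp_all add: inst_subst assms step.intros)

text \<open>The pending call sits in evaluation position and its answer affects nothing around it,
  so one context \<open>E\<close> serves all answers. This lets the value computed by the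
  interpreted oracle be fed back as the answer of \<open>ostep\<close>.\<close>

lemma inst_call:
  "ostep k M q M' \<Longrightarrow> q = Some (c, P) \<Longrightarrow>
    \<exists>E. ectx E \<and> inst F G M = E (inst F G (Con c) \<^bold>\<cdot> inst F G P) \<and>
      (\<forall>k'. \<exists>M''. ostep k' M (Some (c, P)) M'' \<and> inst F G M'' = E (Num k'))"
proof (induction rule: ostep.induct)
  case (call c' P')
  then show ?case using ectx_id ostep.call by fastforce
next
  case (ctx_app M q M' N)
  then obtain E where E: "ectx E" "inst F G M = E (inst F G (Con c) \<^bold>\<cdot> inst F G P)"
    "\<forall>k'. \<exists>M''. ostep k' M (Some (c, P)) M'' \<and> inst F G M'' = E (Num k')" by blast
  show ?case
    by (rule exI[of _ "\<lambda>X. E X \<^bold>\<cdot> inst F G N"])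
      (use E ectx_comp[OF ectx_frames(1) E(1)] ostep.ctx_app in \<open>simp; metis inst.simps(3)\<close>)
next
  case (ctx_suc M q M')
  then obtain E where E: "ectx E" "inst F G M = E (inst F G (Con c) \<^bold>\<cdot> inst F G P)"
    "\<forall>k'. \<exists>M''. ostep k' M (Some (c, P)) M'' \<and> inst F G M'' = E (Num k')" by blast
  show ?case
    by (rule exI[of _ "\<lambda>X. Con CSuc \<^bold>\<cdot> E X"])
      (use E ectx_comp[OF ectx_frames(2) E(1)] ostep.ctx_suc in \<open>simp; fastforce\<close>)
next
  case (ctx_pre M q M')
  then obtain E where E: "ectx E" "inst F G M = E (inst F G (Con c) \<^bold>\<cdot> inst F G P)"
    "\<forall>k'. \<exists>M''. ostep k' M (Some (c, P)) M'' \<and> inst F G M'' = E (Num k')" by blast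
  show ?case
    by (rule exI[of _ "\<lambda>X. Con CPre \<^bold>\<cdot> E X"])
      (use E ectx_comp[OF ectx_frames(3) E(1)] ostep.ctx_pre in \<open>simp; fastforce\<close>)
next
  case (ctx_ifzero M q M')
  then obtain E where E: "ectx E" "inst F G M = E (inst F G (Con c) \<^bold>\<cdot> inst F G P)"
    "\<forall>k'. \<exists>M''. ostep k' M (Some (c, P)) M'' \<and> inst F G M'' = E (Num k')" by blast
  show ?case
    by (rule exI[of _ "\<lambda>X. Con CIfzero \<^bold>\<cdot> E X"])
      (use E ectx_comp[OF ectx_frames(4) E(1)] ostep.ctx_ifzero in \<open>simp; fastforce\<close>)
next
  case (ctx_rec M q M' \<sigma> X H)
  then obtain E where E: "ectx E" "inst F G M = E (inst F G (Con c) \<^bold>\<cdot> inst F G P)"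
    "\<forall>k'. \<exists>M''. ostep k' M (Some (c, P)) M'' \<and> inst F G M'' = E (Num k')" by blast
  show ?case
    by (rule exI[of _ "\<lambda>Y. Con (CRec \<sigma>) \<^bold>\<cdot> inst F G X \<^bold>\<cdot> inst F G H \<^bold>\<cdot> E Y"])
      (use E ectx_comp[OF ectx_frames(5) E(1)] ostep.ctx_rec in \<open>simp; fastforce\<close>)
next
  case (ctx_min M q M' H)
  then obtain E where E: "ectx E" "inst F G M = E (inst F G (Con c) \<^bold>\<cdot> inst F G P)"
    "\<forall>k'. \<exists>M''. ostep k' M (Some (c, P)) M'' \<and> inst F G M'' = E (Num k')" by blast
  show ?case
    by (rule exI[of _ "\<lambda>X. Con CMin \<^bold>\<cdot> inst F G H \<^bold>\<cdot> E X"])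
      (use E ectx_comp[OF ectx_frames(6) E(1)] ostep.ctx_min in \<open>simp; fastforce\<close>)
qed simp_all

section \<open>The adversary\<close>

text \<open>\<open>FD 0 s\<close> returns the value of its argument at the first position where that differs from
  \<open>s\<close>, or at position \<open>length s\<close> if there is none.\<close>

primrec FD :: "nat \<Rightarrow> nat list \<Rightarrow> dt" where
  "FD j [] = Ask j Echo"
| "FD j (x # xs) = Ask j (IfEq x (FD (Suc j) xs) Echo)"

lemma Ex_split0: "(\<exists>j. P j) \<longleftrightarrow> P 0 \<or> (\<exists>j. P (Suc j))"
  by (metis not0_implies_Suc)

lemma run_FD:
  "run Q (FD j s) a k \<longleftrightarrow>
    (\<exists>l\<le>length s. (\<forall>i<l. Q (j + i) (s ! i)) \<and> Q (j + l) k \<and> (l < length s \<longrightarrow> k \<noteq> s ! l))"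
proof (induction s arbitrary: j a)
  case (Cons x xs)
  show ?case
    unfolding Ex_split0[where P = "\<lambda>l. l \<le> length (x # xs) \<and> _ l"]
    by (auto simp: Cons.IH All_less_Suc2)
qed simp

locale coding =
  fixes code :: "nat list \<Rightarrow> nat"
  assumes inj_code: "inj code"
begin

text \<open>The value that the leaf equation prescribes at the child 0 of \<open>xs\<close>. For
  \<open>xs\<close> on the path this child is a leaf, because the entries of the path are at least
  2.\<close>

definition pw :: "nat list \<Rightarrow> nat" where
  "pw xs = 2 * code (xs @ [0]) + 1"

lemma pw_eq_iff [simp]: "pw xs = pw ys \<longleftrightarrow> xs = ys"
  using inj_code by (auto simp: pw_def inj_eq)

text \<open>The answer at \<open>0\<close> is a password: \<open>pw xs\<close> tells that the argument of \<open>G\<close> is the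
  restriction of bar recursion to the children of the node \<open>xs\<close>. The secret \<open>c\<close> is given away
  at the node \<open>s\<close>, and at a proper prefix of \<open>s\<close> only if the argument knows it at the child on \<open>s\<close>.
  For \<open>c = 0\<close> the result is always \<open>0\<close>.\<close>

fun GDr :: "nat \<Rightarrow> nat list \<Rightarrow> nat list \<Rightarrow> dt" where
  "GDr c ys [] = IfEq (pw ys) (Ret c) (Ret 0)"
| "GDr c ys (x # xs) =
    IfEq (pw ys) (Ask x (IfEq c (Ret c) (Ret 0))) (GDr c (ys @ [x]) xs)"

definition GD :: "nat list \<Rightarrow> nat \<Rightarrow> dt" where
  "GD s c = Ask 0 (GDr c [] s)"

lemma run_GDr_inner:
  "j < length xs \<Longrightarrow> run Q (GDr c ys xs) (pw (ys @ take j xs)) k \<longleftrightarrow>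
    (\<exists>u. Q (xs ! j) u \<and> k = (if u = c then c else 0))"
proof (induction xs arbitrary: ys j)
  case (Cons x xs)
  show ?case
  proof (cases j)
    case 0
    then show ?thesis by auto
  next
    case (Suc j')
    with Cons.IH[of j' "ys @ [x]"] Cons.prems show ?thesis by simp
  qed
qed simp

lemma run_GDr_end: "run Q (GDr c ys xs) (pw (ys @ xs)) k \<longleftrightarrow> k = c"
proof (induction xs arbitrary: ys)
  case (Cons x xs)
  from Cons.IH[of "ys @ [x]"] show ?case by simp
qed simp

lemma run_GDr_other:
  "(\<forall>j\<le>length xs. w \<noteq> pw (ys @ take j xs)) \<Longrightarrow> run Q (GDr c ys xs) w k \<longleftrightarrow> k = 0"
proof (induction xs arbitrary: ys)
  case (Cons x xs)
  have "w \<noteq> pw (ys @ [x] @ take j xs)" if "j \<le> length xs" for j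
    using Cons.prems[rule_format, of "Suc j"] that by simp
  with Cons.IH[of "ys @ [x]"] Cons.prems[rule_format, of 0] show ?case by simp
qed simp

definition odt :: "nat list \<Rightarrow> nat \<Rightarrow> const \<Rightarrow> dt" where
  "odt s c o' = (if o' = CRecstr then FD 0 s else GD s c)"

abbreviation inst' :: "nat list \<Rightarrow> nat \<Rightarrow> tm \<Rightarrow> tm" where
  "inst' s c \<equiv> inst (dtm (FD 0 s)) (dtm (GD s c))"

abbreviation conv :: "nat list \<Rightarrow> nat \<Rightarrow> tm \<Rightarrow> nat \<Rightarrow> bool" where
  "conv s c M \<equiv> evaluates (inst' s c M)"

lemma cl_dtm: "cl 0 (dtm D)"
  using closed_term_dtm by (rule closed_term_cl)

lemma inst'_step: "ostep k M None M' \<Longrightarrow> inst' s c M \<leadsto> inst' s c M'"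
  using inst_step[OF cl_dtm cl_dtm] by blast

lemma conv_pure: "ostep k M None M' \<Longrightarrow> conv s c M v \<longleftrightarrow> conv s c M' v"
  using inst'_step evaluates_expand evaluates_reduce by (metis r_into_rtranclp)

lemma steps_pure:
  assumes "ostep k M None M'" and "(step ^^ n) (inst' s c M) (Num v)"
  shows "\<exists>n'<n. (step ^^ n') (inst' s c M') (Num v)"
proof -
  note st = inst'_step[OF assms(1), of s c]
  with assms(2) obtain m where "n = Suc m" by (cases n) auto
  with assms(2) st step_det show ?thesis by (metis lessI relpowp_Suc_D2)
qed

lemma inst'_call:
  assumes "ostep k M (Some (o', P)) M'"
  obtains E where "ectx E" "inst' s c M = E (dtm (odt s c o') \<^bold>\<cdot> inst' s c P)"
    "\<And>k'. \<exists>M''. ostep k' M (Some (o', P)) M'' \<and> inst' s c M'' = E (Num k')"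
proof -
  have "o' \<in> oracles" if "ostep k M q M'" "q = Some (o', P)" for q
    using that by (induction rule: ostep.induct) auto
  with assms have "inst' s c (Con o') = dtm (odt s c o')"
    by (auto simp: oracles_def odt_def)
  with that inst_call[OF assms refl, of "dtm (FD 0 s)" "dtm (GD s c)"] show thesis by metis
qed

lemma steps_call:
  assumes "ostep k M (Some (o', P)) M'" and "(step ^^ n) (inst' s c M) (Num v)"
  obtains k' M'' n' where
    "run (\<lambda>q a. \<exists>m<n. (step ^^ m) (inst' s c (P \<^bold>\<cdot> Num q)) (Num a)) (odt s c o') 0 k'"
    "ostep k' M (Some (o', P)) M''" "n' < n" "(step ^^ n') (inst' s c M'') (Num v)"
proof -
  from inst'_call[OF assms(1), of s c] obtain E where
    E: "ectx E" "inst' s c M = E (dtm (odt s c o') \<^bold>\<cdot> inst' s c P)"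
    "\<And>k'. \<exists>M''. ostep k' M (Some (o', P)) M'' \<and> inst' s c M'' = E (Num k')" by blast
  from dtm_inv[OF E(1) assms(2)[unfolded E(2)]] obtain k' n' where
    "run (\<lambda>q a. \<exists>m<n. (step ^^ m) (inst' s c P \<^bold>\<cdot> Num q) (Num a)) (odt s c o') 0 k'"
    "n' < n" "(step ^^ n') (E (Num k')) (Num v)" by blast
  with E(3)[of k'] that show thesis by fastforce
qed

lemma conv_call:
  assumes "ostep k M (Some (o', P)) M'"
  shows "conv s c M v \<longleftrightarrow> (\<exists>k' M''. run (\<lambda>q. conv s c (P \<^bold>\<cdot> Num q)) (odt s c o') 0 k' \<and>
    ostep k' M (Some (o', P)) M'' \<and> conv s c M'' v)" (is "_ \<longleftrightarrow> ?R")
proof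
  assume "conv s c M v"
  then obtain n where "(step ^^ n) (inst' s c M) (Num v)" by (auto simp: evaluates_relpowp)
  from steps_call[OF assms this] obtain k' M'' n' where
    *: "run (\<lambda>q a. \<exists>m<n. (step ^^ m) (inst' s c (P \<^bold>\<cdot> Num q)) (Num a)) (odt s c o') 0 k'"
    "ostep k' M (Some (o', P)) M''" "(step ^^ n') (inst' s c M'') (Num v)" .
  from *(1) have "run (\<lambda>q. conv s c (P \<^bold>\<cdot> Num q)) (odt s c o') 0 k'"
    by (rule run_mono) (auto simp: evaluates_relpowp)
  with * show ?R by (auto simp: evaluates_relpowp)
next
  assume ?R
  then obtain k' M'' where R: "run (\<lambda>q. conv s c (P \<^bold>\<cdot> Num q)) (odt s c o') 0 k'"
    "ostep k' M (Some (o', P)) M''" "conv s c M'' v" by blast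
  from inst'_call[OF assms, of s c] obtain E where
    E: "ectx E" "inst' s c M = E (dtm (odt s c o') \<^bold>\<cdot> inst' s c P)"
    "\<And>k'. \<exists>M''. ostep k' M (Some (o', P)) M'' \<and> inst' s c M'' = E (Num k')" by blast
  from E(3)[of k'] R(2) have "inst' s c M'' = E (Num k')" using ostep_det by blast
  moreover have "step\<^sup>*\<^sup>* (inst' s c M) (E (Num k'))"
    unfolding E(2) using R(1) by (intro ectx_steps[OF E(1)] dtm_run) simp
  ultimately show "conv s c M v" using R(3) evaluates_expand by metis
qed

lemma run_det:
  "run Q D a k \<Longrightarrow> run Q D a k' \<Longrightarrow> (\<And>q a b. Q q a \<Longrightarrow> Q q b \<Longrightarrow> a = b) \<Longrightarrow> k = k'"
proof (induction D arbitrary: a)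
  case (Ask q D)
  then show ?case by (metis run.simps(4))
qed (auto split: if_splits)

section \<open>Deciding computations\<close>

text \<open>Entries from 2 on avoid the defaults 0 and 1 of the bar condition and the child 0 that
  supplies the password. \<open>ext t t\<close> says that \<open>t\<close> is an admissible
  path.\<close>

definition ext :: "nat list \<Rightarrow> nat list \<Rightarrow> bool" where
  "ext t s \<longleftrightarrow> prefix t s \<and> (\<forall>x\<in>set s. 2 \<le> x)"

text \<open>As in forcing, some condition \<open>t'\<close> below \<open>t\<close> settles the
  alternative for all its extensions. \<open>D\<close> is meant for divergence under the secret 0,
  \<open>C s c\<close> for convergence under the secret \<open>c\<close>; the bound \<open>K\<close>
  keeps nonzero secrets above the values they are compared with.\<close>

definition decided :: "nat list \<Rightarrow> (nat list \<Rightarrow> nat \<Rightarrow> bool) \<Rightarrow> (nat list \<Rightarrow> bool) \<Rightarrow> bool" where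
  "decided t C D \<longleftrightarrow> (\<exists>t'. ext t t' \<and>
    ((\<forall>s. ext t' s \<longrightarrow> D s) \<or> (\<exists>K. \<forall>s c. ext t' s \<longrightarrow> c = 0 \<or> K < c \<longrightarrow> C s c)))"

lemma ext_trans: "ext t t' \<Longrightarrow> ext t' s \<Longrightarrow> ext t s"
  by (auto simp: ext_def)

lemma ext_refl_right: "ext t s \<Longrightarrow> ext s s"
  by (auto simp: ext_def)

lemma decided_ext: "ext t t' \<Longrightarrow> decided t' C D \<Longrightarrow> decided t C D"
  unfolding decided_def using ext_trans by blast

text \<open>Once \<open>t'\<close> has settled the alternative, all its extensions inherit the
  verdict. This turns a decision at one path into the form that the second premise of
  \<open>decided_bind\<close> requires.\<close>

lemma decided_persistent:
  assumes "decided t C D"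
  shows "\<exists>t'. ext t t' \<and> (\<forall>t''. ext t' t'' \<longrightarrow> decided t'' C D)"
proof -
  from assms obtain t' where t': "ext t t'"
    "(\<forall>s. ext t' s \<longrightarrow> D s) \<or> (\<exists>K. \<forall>s c. ext t' s \<longrightarrow> c = 0 \<or> K < c \<longrightarrow> C s c)"
    unfolding decided_def by blast
  have "decided t'' C D" if t'': "ext t' t''" for t''
    unfolding decided_def
  proof (rule exI[of _ t''], rule conjI[OF ext_refl_right[OF t'']])
    show "(\<forall>s. ext t'' s \<longrightarrow> D s) \<or> (\<exists>K. \<forall>s c. ext t'' s \<longrightarrow> c = 0 \<or> K < c \<longrightarrow> C s c)"
      using t'(2) ext_trans[OF t''] by blast
  qed
  with t'(1) show ?thesis by blast
qed

text \<open>Sequencing of two computations. The second must be decided at every extension of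
  \<open>t\<close>, since deciding the first may already have lengthened \<open>t\<close>. The bound
  \<open>K\<close> lets the combination assume a large secret.\<close>

lemma decided_bind:
  assumes "decided t C1 D1"
    and "\<And>t'. ext t t' \<Longrightarrow> decided t' C2 D2"
    and "\<And>s. ext t s \<Longrightarrow> D1 s \<Longrightarrow> D s"
    and "\<And>s. ext t s \<Longrightarrow> C1 s 0 \<Longrightarrow> D2 s \<Longrightarrow> D s"
    and "\<And>s c. ext t s \<Longrightarrow> c = 0 \<or> K < c \<Longrightarrow> C1 s c \<Longrightarrow> C2 s c \<Longrightarrow> C s c"
  shows "decided t C D"
proof -
  from assms(1) obtain t1 where t1: "ext t t1"
    "(\<forall>s. ext t1 s \<longrightarrow> D1 s) \<or> (\<exists>K. \<forall>s c. ext t1 s \<longrightarrow> c = 0 \<or> K < c \<longrightarrow> C1 s c)"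
    unfolding decided_def by blast
  show ?thesis
    using t1(2)
  proof (elim disjE exE)
    assume "\<forall>s. ext t1 s \<longrightarrow> D1 s"
    then show ?thesis unfolding decided_def using t1(1) assms(3) ext_trans by blast
  next
    fix K1 assume C1: "\<forall>s c. ext t1 s \<longrightarrow> c = 0 \<or> K1 < c \<longrightarrow> C1 s c"
    from assms(2)[OF t1(1)] obtain t2 where t2: "ext t1 t2"
      "(\<forall>s. ext t2 s \<longrightarrow> D2 s) \<or> (\<exists>K. \<forall>s c. ext t2 s \<longrightarrow> c = 0 \<or> K < c \<longrightarrow> C2 s c)"
      unfolding decided_def by blast
    have e: "ext t1 s \<and> ext t s" if "ext t2 s" for s
      using that t1(1) t2(1) ext_trans by blast
    show ?thesis
      using t2(2)
    proof (elim disjE exE)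
      assume "\<forall>s. ext t2 s \<longrightarrow> D2 s"
      with C1 e assms(4) have "\<forall>s. ext t2 s \<longrightarrow> D s" by blast
      then show ?thesis unfolding decided_def using t1(1) t2(1) ext_trans by blast
    next
      fix K2 assume C2: "\<forall>s c. ext t2 s \<longrightarrow> c = 0 \<or> K2 < c \<longrightarrow> C2 s c"
      have "C s c" if "ext t2 s" "c = 0 \<or> max K (max K1 K2) < c" for s c
        using that(2) e[OF that(1)] C1 C2 that(1) by (intro assms(5)) auto
      then show ?thesis unfolding decided_def using t1(1) t2(1) ext_trans by blast
    qed
  qed
qed

lemma decided_mono:
  assumes "decided t C D"
    and "\<And>s. ext t s \<Longrightarrow> D s \<Longrightarrow> D' s"
    and "\<And>s c. ext t s \<Longrightarrow> c = 0 \<or> K < c \<Longrightarrow> C s c \<Longrightarrow> C' s c"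
  shows "decided t C' D'"
proof (rule decided_bind[OF assms(1), where ?C2.0 = "\<lambda>_ _. True" and ?D2.0 = "\<lambda>_. False"])
  show "decided t' (\<lambda>_ _. True) (\<lambda>_. False)" if "ext t t'" for t'
    using ext_refl_right[OF that] unfolding decided_def by blast
qed (use assms in auto)

text \<open>The negative case records that all queries before the divergent one answer as expected,
  which determines how far a tree asking in this order can get.\<close>

lemma decided_all:
  assumes "ext t t" and "\<And>j t'. j < (l::nat) \<Longrightarrow> ext t t' \<Longrightarrow> decided t' (C j) (D j)"
  shows "decided t (\<lambda>s c. \<forall>j<l. C j s c) (\<lambda>s. \<exists>j<l. D j s \<and> (\<forall>i<j. C i s 0))"
  using assms(2)
proof (induction l)
  case 0
  show ?case using assms(1) unfolding decided_def by auto
next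
  case (Suc l)
  show ?case
  proof (rule decided_bind[OF Suc.IH Suc.prems])
    fix s assume "\<exists>j<l. D j s \<and> (\<forall>i<j. C i s 0)"
    then show "\<exists>j<Suc l. D j s \<and> (\<forall>i<j. C i s 0)" using less_SucI by blast
  next
    fix s c assume "\<forall>j<l. C j s c" "C l s c"
    then show "\<forall>j<Suc l. C j s c" by (simp add: less_Suc_eq)
  qed (use Suc.prems in auto)
qed

text \<open>Genericity of the next entry: \<open>B\<close> is found after a run under
  \<open>s\<close> is known, and every \<open>x\<close> beyond it counts as fresh for that
  run.\<close>

definition forced :: "nat list \<Rightarrow> (nat list \<Rightarrow> nat \<Rightarrow> bool) \<Rightarrow> (nat list \<Rightarrow> bool) \<Rightarrow> bool" where
  "forced s C D \<longleftrightarrow> (\<exists>B. \<forall>x>B. \<forall>t. ext (s @ [x]) t \<longrightarrow> decided t C D)"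

lemma forced_all:
  "(\<And>j. j < (l::nat) \<Longrightarrow> forced s (C j) (D j)) \<Longrightarrow>
    \<exists>B. \<forall>j<l. \<forall>x>B. \<forall>t. ext (s @ [x]) t \<longrightarrow> decided t (C j) (D j)"
proof (induction l)
  case (Suc l)
  then obtain B where B: "\<forall>j<l. \<forall>x>B. \<forall>t. ext (s @ [x]) t \<longrightarrow> decided t (C j) (D j)"
    by auto
  from Suc.prems[of l] obtain B' where
    "\<forall>x>B'. \<forall>t. ext (s @ [x]) t \<longrightarrow> decided t (C l) (D l)"
    unfolding forced_def by auto
  with B have "\<forall>j<Suc l. \<forall>x>max B B'. \<forall>t. ext (s @ [x]) t \<longrightarrow> decided t (C j) (D j)"
    by (auto simp: less_Suc_eq)
  then show ?case by blast
qed simp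

abbreviation diverges :: "tm \<Rightarrow> nat list \<Rightarrow> bool" where
  "diverges M s \<equiv> \<forall>v. \<not> conv s 0 M v"

definition claim :: "tm \<Rightarrow> bool" where
  "claim M \<longleftrightarrow> (\<forall>t. ext t t \<longrightarrow> (\<exists>v. decided t (\<lambda>s c. conv s c M v) (diverges M)))"

lemma call_decided:
  assumes call: "ostep k M (Some (o', P)) M'"
    and "decided t (\<lambda>s c. run (\<lambda>q. conv s c (P \<^bold>\<cdot> Num q)) (odt s c o') 0 k)
      (\<lambda>s. \<forall>k. \<not> run (\<lambda>q. conv s 0 (P \<^bold>\<cdot> Num q)) (odt s 0 o') 0 k)"
    and "\<And>t'. ext t t' \<Longrightarrow> decided t' (\<lambda>s c. conv s c M' v) (diverges M')"
  shows "decided t (\<lambda>s c. conv s c M v) (diverges M)"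
proof (rule decided_bind[OF assms(2,3), where K = 0])
  fix s assume "\<forall>k. \<not> run (\<lambda>q. conv s 0 (P \<^bold>\<cdot> Num q)) (odt s 0 o') 0 k"
  then show "diverges M s" using conv_call[OF call] by blast
next
  fix s assume run: "run (\<lambda>q. conv s 0 (P \<^bold>\<cdot> Num q)) (odt s 0 o') 0 k"
    and div: "diverges M' s"
  show "diverges M s"
  proof (intro allI notI)
    fix v assume "conv s 0 M v"
    then obtain k' M'' where "run (\<lambda>q. conv s 0 (P \<^bold>\<cdot> Num q)) (odt s 0 o') 0 k'"
      "ostep k' M (Some (o', P)) M''" "conv s 0 M'' v"
      using conv_call[OF call] by blast
    moreover from this(1) run have "k' = k" by (rule run_det) (rule evaluates_det)
    ultimately show False using div call ostep_det by blast
  qed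
next
  fix s c assume "run (\<lambda>q. conv s c (P \<^bold>\<cdot> Num q)) (odt s c o') 0 k" "conv s c M' v"
  then show "conv s c M v" using conv_call[OF call] call by blast
qed

lemma child_ostep: "ostep k M q M' \<Longrightarrow> child M' N \<Longrightarrow> child M N"
  using reach_step unfolding child_def by blast

lemma good_ostep:
  assumes "good M" and "ostep k M q M'"
  shows "good M'"
proof (rule good.intros)
  fix N assume "child M' N"
  with assms child_ostep good_child show "good N" by blast
next
  show "safe M'"
    using good_safe[OF assms(1)] reach_step[OF assms(2)] unfolding safe_def by blast
qed

lemma child_trancl_ostep: "ostep k M q M' \<Longrightarrow> child\<^sup>+\<^sup>+ M' N \<Longrightarrow> child\<^sup>+\<^sup>+ M N"
  by (erule converse_tranclpE) (meson child_ostep tranclp.r_into_trancl tranclp_into_tranclp2)+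

section \<open>Replaying runs under fresh extensions of the path\<close>

lemma ext_snocD:
  assumes "ext (s0 @ [x]) s"
  shows "length s0 < length s" "j \<le> length s0 \<Longrightarrow> take j s = take j s0"
    "j < length s0 \<Longrightarrow> s ! j = s0 ! j" "s ! length s0 = x"
    "length s0 < j \<Longrightarrow> x \<in> set (take j s)"
proof -
  from assms obtain r where s: "s = s0 @ x # r" by (auto simp: ext_def prefix_def)
  show "length s0 < length s" "j \<le> length s0 \<Longrightarrow> take j s = take j s0"
    "j < length s0 \<Longrightarrow> s ! j = s0 ! j" "s ! length s0 = x"
    "length s0 < j \<Longrightarrow> x \<in> set (take j s)"
    by (simp_all add: s nth_append take_Cons')
qed

text \<open>For \<open>x\<close> above the old answer \<open>k'\<close>, the argument still first
  deviates from the path at the old position \<open>l\<close>: if \<open>l = length s0\<close>, the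
  path now continues there with \<open>x\<close>, which differs from \<open>k'\<close>.\<close>

lemma forced_FD:
  assumes query: "\<And>i a. Q i a \<Longrightarrow> forced s0 (\<lambda>s c. conv s c (P \<^bold>\<cdot> Num i) a) (diverges (P \<^bold>\<cdot> Num i))"
    and run: "run Q (FD 0 s0) 0 k'"
  shows "\<exists>B. \<forall>x>B. \<forall>t. ext (s0 @ [x]) t \<longrightarrow>
    decided t (\<lambda>s c. run (\<lambda>i. conv s c (P \<^bold>\<cdot> Num i)) (FD 0 s) 0 k')
      (\<lambda>s. \<forall>k. \<not> run (\<lambda>i. conv s 0 (P \<^bold>\<cdot> Num i)) (FD 0 s) 0 k)"
proof -
  from run obtain l where l: "l \<le> length s0" "\<And>i. i < l \<Longrightarrow> Q i (s0 ! i)" "Q l k'"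
    "l < length s0 \<Longrightarrow> k' \<noteq> s0 ! l"
    unfolding run_FD by auto
  define ans where "ans i = (if i < l then s0 ! i else k')" for i
  have "Q i (ans i)" if "i < Suc l" for i
    using l(2,3) that by (auto simp: ans_def less_Suc_eq)
  then have "forced s0 (\<lambda>s c. conv s c (P \<^bold>\<cdot> Num i) (ans i)) (diverges (P \<^bold>\<cdot> Num i))"
    if "i < Suc l" for i
    using that by (intro query) simp
  from forced_all[OF this] obtain B where "\<forall>i<Suc l. \<forall>x>B. \<forall>t. ext (s0 @ [x]) t \<longrightarrow>
      decided t (\<lambda>s c. conv s c (P \<^bold>\<cdot> Num i) (ans i)) (diverges (P \<^bold>\<cdot> Num i))" ..
  note B = this[rule_format]
  have "decided t (\<lambda>s c. run (\<lambda>i. conv s c (P \<^bold>\<cdot> Num i)) (FD 0 s) 0 k')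
      (\<lambda>s. \<forall>k. \<not> run (\<lambda>i. conv s 0 (P \<^bold>\<cdot> Num i)) (FD 0 s) 0 k)"
    if x: "max B k' < x" and t: "ext (s0 @ [x]) t" for x t
  proof -
    have "decided t (\<lambda>s c. \<forall>i<Suc l. conv s c (P \<^bold>\<cdot> Num i) (ans i))
      (\<lambda>s. \<exists>i<Suc l. diverges (P \<^bold>\<cdot> Num i) s \<and> (\<forall>i'<i. conv s 0 (P \<^bold>\<cdot> Num i') (ans i')))"
      using x ext_trans[OF t] by (intro decided_all ext_refl_right[OF t] B) auto
    then show ?thesis
    proof (rule decided_mono[where K = 0])
      fix s assume "ext t s"
        and div: "\<exists>i<Suc l. diverges (P \<^bold>\<cdot> Num i) s \<and> (\<forall>i'<i. conv s 0 (P \<^bold>\<cdot> Num i') (ans i'))"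
      with t have s: "ext (s0 @ [x]) s" using ext_trans by blast
      show "\<forall>k. \<not> run (\<lambda>i. conv s 0 (P \<^bold>\<cdot> Num i)) (FD 0 s) 0 k"
      proof (intro allI notI)
        fix k assume "run (\<lambda>i. conv s 0 (P \<^bold>\<cdot> Num i)) (FD 0 s) 0 k"
        then obtain l' where l': "\<And>i. i < l' \<Longrightarrow> conv s 0 (P \<^bold>\<cdot> Num i) (s ! i)"
          "conv s 0 (P \<^bold>\<cdot> Num l') k" "l' < length s \<Longrightarrow> k \<noteq> s ! l'"
          unfolding run_FD by auto
        from div obtain i where i: "i < Suc l" "diverges (P \<^bold>\<cdot> Num i) s"
          "\<And>i'. i' < i \<Longrightarrow> conv s 0 (P \<^bold>\<cdot> Num i') (ans i')" by blast
        \<comment> \<open>A run cannot get past the divergent query \<open>i\<close>. It cannot stop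
          before \<open>i\<close> either, since the answers up to there agree with the path.\<close>
        have "l' < i"
          using i(2) l'(1)[of i] l'(2) by (cases i l' rule: linorder_cases) auto
        then have "conv s 0 (P \<^bold>\<cdot> Num l') (ans l')" "l' < l" using i(1,3) by auto
        with l'(2) have "k = s0 ! l'" using evaluates_det[of _ k "ans l'"] by (simp add: ans_def)
        with l'(3) l(1) \<open>l' < l\<close> ext_snocD(1)[OF s] ext_snocD(3)[OF s, of l']
        show False by simp
      qed
    next
      fix s c assume "ext t s" and conv: "\<forall>i<Suc l. conv s c (P \<^bold>\<cdot> Num i) (ans i)"
      with t have s: "ext (s0 @ [x]) s" using ext_trans by blast
      have "conv s c (P \<^bold>\<cdot> Num i) (s ! i)" if "i < l" for i
        using conv[rule_format, of i] that l(1) ext_snocD(3)[OF s, of i] by (simp add: ans_def)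
      moreover have "conv s c (P \<^bold>\<cdot> Num l) k'"
        using conv[rule_format, of l] by (simp add: ans_def)
      moreover have "k' \<noteq> s ! l"
        using l(1,4) x ext_snocD(3,4)[OF s] by (cases "l = length s0") auto
      ultimately show "run (\<lambda>i. conv s c (P \<^bold>\<cdot> Num i)) (FD 0 s) 0 k'"
        unfolding run_FD using l(1) ext_snocD(1)[OF s] by (intro exI[of _ l]) auto
    qed
  qed
  then show ?thesis by blast
qed

text \<open>Under the secret 0 the old answer \<open>k'\<close> is 0. The cases ask whether the
  value \<open>w\<close> at 0 is the password of a proper prefix of \<open>s0\<close>, of
  \<open>s0\<close>, or neither; in each the answer stays 0 for large secrets, unless a query
  diverges under the secret 0.\<close>

lemma forced_GD:
  assumes query: "\<And>i a. Q i a \<Longrightarrow> forced s0 (\<lambda>s c. conv s c (P \<^bold>\<cdot> Num i) a) (diverges (P \<^bold>\<cdot> Num i))"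
    and run: "run Q (GD s0 0) 0 k'"
    and claim: "\<And>i. claim (P \<^bold>\<cdot> Num i)"
  shows "\<exists>B. \<forall>x>B. \<forall>t. ext (s0 @ [x]) t \<longrightarrow>
    decided t (\<lambda>s c. run (\<lambda>i. conv s c (P \<^bold>\<cdot> Num i)) (GD s c) 0 k')
      (\<lambda>s. \<forall>k. \<not> run (\<lambda>i. conv s 0 (P \<^bold>\<cdot> Num i)) (GD s 0) 0 k)"
proof -
  from run obtain w where w: "Q 0 w" "run Q (GDr 0 [] s0) w k'"
    unfolding GD_def by auto
  from query[OF w(1)] obtain B where B: "\<And>x t. B < x \<Longrightarrow> ext (s0 @ [x]) t \<Longrightarrow>
      decided t (\<lambda>s c. conv s c (P \<^bold>\<cdot> Num 0) w) (diverges (P \<^bold>\<cdot> Num 0))"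
    unfolding forced_def by blast
  have div0: "\<forall>k. \<not> run (\<lambda>i. conv s 0 (P \<^bold>\<cdot> Num i)) (GD s 0) 0 k" if "diverges (P \<^bold>\<cdot> Num 0) s" for s
    using that by (simp add: GD_def)
  have run_w: "run (\<lambda>i. conv s c (P \<^bold>\<cdot> Num i)) (GD s c) 0 k \<longleftrightarrow>
      run (\<lambda>i. conv s c (P \<^bold>\<cdot> Num i)) (GDr c [] s) w k" if "conv s c (P \<^bold>\<cdot> Num 0) w" for s c k
    using that evaluates_det by (auto simp: GD_def)
  \<comment> \<open>Treats the passwords of all prefixes of \<open>s0\<close> at once:
    \<open>(s0 @ [x]) ! j\<close> is the next entry of the path, which is the fresh \<open>x\<close>
    for \<open>j = length s0\<close>. A secret above \<open>u\<close> fails the comparison with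
    \<open>u\<close>, so the answer is 0.\<close>
  have inner: "decided t (\<lambda>s c. run (\<lambda>i. conv s c (P \<^bold>\<cdot> Num i)) (GD s c) 0 0)
      (\<lambda>s. \<forall>k. \<not> run (\<lambda>i. conv s 0 (P \<^bold>\<cdot> Num i)) (GD s 0) 0 k)"
    if x: "B < x" and t: "ext (s0 @ [x]) t" and j: "j \<le> length s0" "w = pw (take j s0)" "i = (s0 @ [x]) ! j"
      and dec: "\<And>t'. ext t t' \<Longrightarrow> decided t' (\<lambda>s c. conv s c (P \<^bold>\<cdot> Num i) u) (diverges (P \<^bold>\<cdot> Num i))"
    for x t j i u
  proof -
    have GDr: "run (\<lambda>i. conv s c (P \<^bold>\<cdot> Num i)) (GDr c [] s) w k \<longleftrightarrow>
        (\<exists>u. conv s c (P \<^bold>\<cdot> Num i) u \<and> k = (if u = c then c else 0))" if "ext t s" for s c k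
    proof -
      from ext_trans[OF t that] have s: "ext (s0 @ [x]) s" .
      have "s ! j = i" "j < length s" "w = pw (take j s)"
        using j ext_snocD[OF s] by (cases "j = length s0"; simp add: nth_append)+
      with run_GDr_inner[of j s _ c "[]" k] show ?thesis by simp
    qed
    show ?thesis
    proof (rule decided_bind[OF B[OF x t] dec, where K = u])
      fix s assume "ext t s" "conv s 0 (P \<^bold>\<cdot> Num 0) w" "diverges (P \<^bold>\<cdot> Num i) s"
      then show "\<forall>k. \<not> run (\<lambda>i. conv s 0 (P \<^bold>\<cdot> Num i)) (GD s 0) 0 k"
        using run_w[of s 0] GDr[of s 0] by simp
    next
      fix s c assume "ext t s" "c = 0 \<or> u < c" "conv s c (P \<^bold>\<cdot> Num 0) w" "conv s c (P \<^bold>\<cdot> Num i) u"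
      moreover from this
      have "\<exists>u. conv s c (P \<^bold>\<cdot> Num i) u \<and> 0 = (if u = c then c else 0)"
        by (intro exI[of _ u]) auto
      ultimately show "run (\<lambda>i. conv s c (P \<^bold>\<cdot> Num i)) (GD s c) 0 0"
        using run_w GDr by blast
    qed (use div0 in blast)+
  qed
  consider j where "j < length s0" "w = pw (take j s0)" | "w = pw s0"
    | "\<forall>j\<le>length s0. w \<noteq> pw (take j s0)"
    by (metis le_neq_implies_less take_all order_refl)
  then show ?thesis
  proof cases
    case (1 j)
    with w(2) run_GDr_inner[of j s0 Q 0 "[]" k'] obtain u where u: "Q (s0 ! j) u" "k' = 0"
      by (auto split: if_splits)
    from query[OF u(1)] obtain B' where B': "\<And>x t. B' < x \<Longrightarrow> ext (s0 @ [x]) t \<Longrightarrow>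
        decided t (\<lambda>s c. conv s c (P \<^bold>\<cdot> Num (s0 ! j)) u) (diverges (P \<^bold>\<cdot> Num (s0 ! j)))"
      unfolding forced_def by blast
    have "decided t (\<lambda>s c. run (\<lambda>i. conv s c (P \<^bold>\<cdot> Num i)) (GD s c) 0 k')
      (\<lambda>s. \<forall>k. \<not> run (\<lambda>i. conv s 0 (P \<^bold>\<cdot> Num i)) (GD s 0) 0 k)"
      if "max B B' < x" "ext (s0 @ [x]) t" for x t
      unfolding u(2) using that 1
      by (intro inner[of x t j "s0 ! j" u] B'[of x]) (auto simp: nth_append intro: ext_trans)
    then show ?thesis by blast
  next
    case 2
    with w(2) run_GDr_end[of Q 0 "[]" s0 k'] have k': "k' = 0" by simp
    have "decided t (\<lambda>s c. run (\<lambda>i. conv s c (P \<^bold>\<cdot> Num i)) (GD s c) 0 k')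
      (\<lambda>s. \<forall>k. \<not> run (\<lambda>i. conv s 0 (P \<^bold>\<cdot> Num i)) (GD s 0) 0 k)"
      if x: "B < x" and t: "ext (s0 @ [x]) t" for x t
    proof -
      \<comment> \<open>The run under \<open>s0\<close> need not contain a query at
        \<open>x\<close>, so there is no value to replay. The value \<open>u\<close> comes from the
        deeper nesting level, at the price of lengthening \<open>t\<close>.\<close>
      from claim ext_refl_right[OF t] obtain u where
        "decided t (\<lambda>s c. conv s c (P \<^bold>\<cdot> Num x) u) (diverges (P \<^bold>\<cdot> Num x))"
        unfolding claim_def by blast
      from decided_persistent[OF this] obtain t' where t': "ext t t'"
        "\<And>t''. ext t' t'' \<Longrightarrow> decided t'' (\<lambda>s c. conv s c (P \<^bold>\<cdot> Num x) u) (diverges (P \<^bold>\<cdot> Num x))"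
        by blast
      show ?thesis
        unfolding k'
        using inner[OF x ext_trans[OF t t'(1)] order_refl _ _ t'(2)] 2 by (intro decided_ext[OF t'(1)]) simp
    qed
    then show ?thesis by blast
  next
    case 3
    with w(2) run_GDr_other[of s0 w "[]"] have k': "k' = 0" by simp
    \<comment> \<open>\<open>w\<close> might become a password once the path grows. But every longer
      prefix contains \<open>x\<close>, so \<open>x\<close> beyond the entries of the only possible
      \<open>xs\<close> excludes this.\<close>
    obtain B' where B': "\<And>xs. w = pw xs \<Longrightarrow> \<forall>x\<in>set xs. x \<le> B'"
    proof (cases "\<exists>xs. w = pw xs")
      case True
      then obtain xs where "w = pw xs" by blast
      with that[of "sum_list xs"] show thesis using member_le_sum_list by auto
    qed (use that in blast)
    have "decided t (\<lambda>s c. run (\<lambda>i. conv s c (P \<^bold>\<cdot> Num i)) (GD s c) 0 k')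
      (\<lambda>s. \<forall>k. \<not> run (\<lambda>i. conv s 0 (P \<^bold>\<cdot> Num i)) (GD s 0) 0 k)"
      if x: "max B B' < x" and t: "ext (s0 @ [x]) t" for x t
    proof (rule decided_mono[OF B[OF _ t], where K = 0])
      fix s c assume "ext t s" "conv s c (P \<^bold>\<cdot> Num 0) w"
      from ext_trans[OF t this(1)] have s: "ext (s0 @ [x]) s" .
      have "w \<noteq> pw (take j s)" for j
      proof (cases "j \<le> length s0")
        case True
        with 3 ext_snocD(2)[OF s] show ?thesis by simp
      next
        case False
        with ext_snocD(5)[OF s, of j] x B'[of "take j s"] show ?thesis by fastforce
      qed
      with run_GDr_other[of s w "[]"] have "run (\<lambda>i. conv s c (P \<^bold>\<cdot> Num i)) (GDr c [] s) w 0" by simp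
      with \<open>conv s c (P \<^bold>\<cdot> Num 0) w\<close> show "run (\<lambda>i. conv s c (P \<^bold>\<cdot> Num i)) (GD s c) 0 k'"
        using run_w[of s c] by (simp add: k')
    qed (use x div0 in auto)
    then show ?thesis by blast
  qed
qed

text \<open>A run under \<open>(s0, 0)\<close> can be replayed under every generic extension of \<open>s0\<close>. The only calls
  that behave differently there carry the password of \<open>s0\<close>; they ask their argument at the fresh
  number \<open>x\<close>, and the resulting computation is decided by \<open>claim\<close>.\<close>

lemma forced_run:
  assumes "(step ^^ n) (inst' s0 0 M) (Num v)" and "good M" and "\<And>N. child\<^sup>+\<^sup>+ M N \<Longrightarrow> claim N"
  shows "forced s0 (\<lambda>s c. conv s c M v) (diverges M)"
  using assms
proof (induction n arbitrary: M v rule: less_induct)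
  case (less n)
  from good_safe[OF less.prems(2)] consider v' where "M = Num v'" | k q M' where "ostep k M q M'"
    unfolding safe_def by blast
  then show ?case
  proof cases
    case (1 v')
    with less.prems(1) have "evaluates (Num v') v" by (auto simp: evaluates_relpowp)
    then have "M = Num v" using 1 by simp
    then show ?thesis unfolding forced_def decided_def using ext_refl_right by fastforce
  next
    case (2 k q M')
    have IH: "forced s0 (\<lambda>s c. conv s c M'' u) (diverges M'')"
      if "ostep k M q M''" "m < n" "(step ^^ m) (inst' s0 0 M'') (Num u)" for k M'' m u
      using less.prems that by (intro less.IH[OF that(2,3)]) (blast intro: good_ostep child_trancl_ostep)+
    show ?thesis
    proof (cases q)
      case None
      with 2 have st: "ostep k M None M'" by simp
      from steps_pure[OF this less.prems(1)] obtain m where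
        "m < n" "(step ^^ m) (inst' s0 0 M') (Num v)" by blast
      from IH[OF 2 this] show ?thesis by (simp add: conv_pure[OF st])
    next
      case (Some q')
      then obtain o' P where q: "q = Some (o', P)" by (cases q') auto
      from steps_call[OF 2[unfolded q] less.prems(1)] obtain k' M'' n' where
        run: "run (\<lambda>i a. \<exists>m<n. (step ^^ m) (inst' s0 0 (P \<^bold>\<cdot> Num i)) (Num a)) (odt s0 0 o') 0 k'"
        and M'': "ostep k' M (Some (o', P)) M''" "n' < n" "(step ^^ n') (inst' s0 0 M'') (Num v)" .
      let ?Q = "\<lambda>i a. \<exists>m<n. (step ^^ m) (inst' s0 0 (P \<^bold>\<cdot> Num i)) (Num a)"
      have child: "child M (P \<^bold>\<cdot> Num i)" for i
        using 2 unfolding child_def q by blast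
      \<comment> \<open>A query made in the run has a shorter run of its own under \<open>s0\<close>
        and is replayed with the same value. Its \<open>claim\<close> would not do, as that only
        provides some value.\<close>
      have query: "forced s0 (\<lambda>s c. conv s c (P \<^bold>\<cdot> Num i) a) (diverges (P \<^bold>\<cdot> Num i))"
        if "?Q i a" for i a
      proof -
        from that obtain m where "m < n" "(step ^^ m) (inst' s0 0 (P \<^bold>\<cdot> Num i)) (Num a)" by blast
        then show ?thesis
        proof (rule less.IH)
          show "good (P \<^bold>\<cdot> Num i)" using less.prems(2) child by (rule good_child)
          show "claim N" if "child\<^sup>+\<^sup>+ (P \<^bold>\<cdot> Num i) N" for N
            by (rule less.prems(3)) (rule tranclp_into_tranclp2[where r = child, OF child that])
        qed
      qed
      from IH[OF M''(1)[folded q] M''(2,3)] obtain B0 where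
        B0: "\<And>x t. B0 < x \<Longrightarrow> ext (s0 @ [x]) t \<Longrightarrow> decided t (\<lambda>s c. conv s c M'' v) (diverges M'')"
        unfolding forced_def by blast
      have "\<exists>B. \<forall>x>B. \<forall>t. ext (s0 @ [x]) t \<longrightarrow>
        decided t (\<lambda>s c. run (\<lambda>i. conv s c (P \<^bold>\<cdot> Num i)) (odt s c o') 0 k')
          (\<lambda>s. \<forall>k. \<not> run (\<lambda>i. conv s 0 (P \<^bold>\<cdot> Num i)) (odt s 0 o') 0 k)"
      proof (cases "o' = CRecstr")
        case True
        with run forced_FD[OF query] show ?thesis by (simp add: odt_def)
      next
        case False
        have "claim (P \<^bold>\<cdot> Num i)" for i
          using less.prems(3) tranclp.r_into_trancl[of child, OF child] by blast
        with False run forced_GD[OF query] show ?thesis by (simp add: odt_def)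
      qed
      then obtain B1 where B1: "\<And>x t. B1 < x \<Longrightarrow> ext (s0 @ [x]) t \<Longrightarrow>
        decided t (\<lambda>s c. run (\<lambda>i. conv s c (P \<^bold>\<cdot> Num i)) (odt s c o') 0 k')
          (\<lambda>s. \<forall>k. \<not> run (\<lambda>i. conv s 0 (P \<^bold>\<cdot> Num i)) (odt s 0 o') 0 k)"
        by blast
      have "decided t (\<lambda>s c. conv s c M v) (diverges M)" if "max B0 B1 < x" "ext (s0 @ [x]) t" for x t
        using that B0 B1 by (intro call_decided[OF M''(1)]) (auto intro: ext_trans)
      then show ?thesis unfolding forced_def by blast
    qed
  qed
qed

text \<open>If \<open>M\<close> diverges under the secret 0 along all extensions of
  \<open>t\<close>, then \<open>t\<close> itself decides. Otherwise a convergent run under some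
  \<open>s0\<close> is replayed above \<open>s0\<close>. All descendants are included because the
  replay also descends into queries of queries.\<close>

lemma good_claim: "good M \<Longrightarrow> claim M \<and> (\<forall>N. child\<^sup>+\<^sup>+ M N \<longrightarrow> claim N)"
proof (induction rule: good.induct)
  case (1 M)
  have good: "good M" using 1(1,2) by (rule good.intros)
  have below: "claim N" if "child\<^sup>+\<^sup>+ M N" for N
    using that by (rule converse_tranclpE) (blast dest: 1(3))+
  have "claim M"
    unfolding claim_def
  proof (intro allI impI)
    fix t assume t: "ext t t"
    show "\<exists>v. decided t (\<lambda>s c. conv s c M v) (diverges M)"
    proof (cases "\<forall>s. ext t s \<longrightarrow> diverges M s")
      case True
      with t show ?thesis unfolding decided_def by blast
    next
      case False
      then obtain s0 v n where s0: "ext t s0" "(step ^^ n) (inst' s0 0 M) (Num v)"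
        by (auto simp: evaluates_relpowp)
      from forced_run[OF s0(2) good below] obtain B where
        B: "\<And>x t. B < x \<Longrightarrow> ext (s0 @ [x]) t \<Longrightarrow> decided t (\<lambda>s c. conv s c M v) (diverges M)"
        unfolding forced_def by blast
      \<comment> \<open>Beyond \<open>B\<close> for freshness, and at least 2 to keep the path
        admissible.\<close>
      define x where "x = max B 1 + 1"
      have "ext s0 (s0 @ [x])" "ext (s0 @ [x]) (s0 @ [x])"
        using ext_refl_right[OF s0(1)] by (auto simp: ext_def x_def)
      moreover from this(2) have "decided (s0 @ [x]) (\<lambda>s c. conv s c M v) (diverges M)"
        by (rule B[rotated]) (simp add: x_def)
      ultimately show ?thesis using s0(1) ext_trans decided_ext by blast
    qed
  qed
  with below show ?case by blast
qed

section \<open>The Kohlenbach tree of the adversary and bar recursion along its path\<close>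

lemma FD_basic:
  assumes "is_basic code basic" and "l \<le> length s"
    and "\<And>i. i < l \<Longrightarrow> (if i < length xs then xs ! i else j) = s ! i"
    and "k = (if l < length xs then xs ! l else j)" and "l < length s \<Longrightarrow> k \<noteq> s ! l"
  shows "evaluates (dtm (FD 0 s) \<^bold>\<cdot> (basic \<^bold>\<cdot> Num (code xs) \<^bold>\<cdot> Num j)) k"
proof -
  let ?P = "basic \<^bold>\<cdot> Num (code xs) \<^bold>\<cdot> Num j"
  have P: "evaluates (?P \<^bold>\<cdot> Num i) (if i < length xs then xs ! i else j)" for i
    using assms(1) unfolding is_basic_def by blast
  have "\<forall>i<l. evaluates (?P \<^bold>\<cdot> Num i) (s ! i)"
    using P assms(3) by metis
  moreover have "evaluates (?P \<^bold>\<cdot> Num l) k"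
    unfolding assms(4) by (rule P)
  ultimately have "run (\<lambda>q. evaluates (?P \<^bold>\<cdot> Num q)) (FD 0 s) 0 k"
    unfolding run_FD using assms(2,5) by (intro exI[of _ l]) simp
  from dtm_run[OF this] show ?thesis by (simp add: evaluates_def)
qed

context
  fixes basic :: tm and s :: "nat list"
  assumes basic: "is_basic code basic" and s_ge: "\<forall>x\<in>set s. 2 \<le> x"
begin

abbreviation tree :: "nat list set" where
  "tree \<equiv> kohlenbach_tree code basic (dtm (FD 0 s))"

lemma nth_ge: "i < length s \<Longrightarrow> 2 \<le> s ! i"
  using s_ge by simp

text \<open>Continued by a default below 2, the prefix leaves \<open>s\<close> exactly at
  \<open>j\<close>, so \<open>FD\<close> returns the default: 0 in one case and 1 in the
  other.\<close>

lemma not_bar_take: "j \<le> length s \<Longrightarrow> \<not> kohlenbach_bar code basic (dtm (FD 0 s)) (take j s)"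
proof
  assume j: "j \<le> length s" and "kohlenbach_bar code basic (dtm (FD 0 s)) (take j s)"
  then obtain k where k:
    "evaluates (dtm (FD 0 s) \<^bold>\<cdot> (basic \<^bold>\<cdot> Num (code (take j s)) \<^bold>\<cdot> Num 0)) k"
    "evaluates (dtm (FD 0 s) \<^bold>\<cdot> (basic \<^bold>\<cdot> Num (code (take j s)) \<^bold>\<cdot> Num 1)) k"
    by (auto simp: kohlenbach_bar_def eval_eq_def)
  have "evaluates (dtm (FD 0 s) \<^bold>\<cdot> (basic \<^bold>\<cdot> Num (code (take j s)) \<^bold>\<cdot> Num b)) b" if "b < 2" for b
    using j nth_ge[of j] that by (intro FD_basic[OF basic, of j]) auto
  from this[of 0] this[of 1] k show False by (auto dest: evaluates_det)
qed

text \<open>The position \<open>j\<close> at which \<open>FD\<close> stops lies inside the sequence,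
  so both defaults give the value \<open>y\<close>.\<close>

lemma bar_snoc:
  assumes "j \<le> length s" "j < length s \<Longrightarrow> y \<noteq> s ! j"
  shows "kohlenbach_bar code basic (dtm (FD 0 s)) (take j s @ [y])"
proof -
  have "evaluates (dtm (FD 0 s) \<^bold>\<cdot> (basic \<^bold>\<cdot> Num (code (take j s @ [y])) \<^bold>\<cdot> Num b)) y" for b
    using assms by (intro FD_basic[OF basic, of j]) (auto simp: nth_append)
  then show ?thesis unfolding kohlenbach_bar_def eval_eq_def by blast
qed

lemma prefix_not_bar: "prefix ys s \<Longrightarrow> \<not> kohlenbach_bar code basic (dtm (FD 0 s)) ys"
  using not_bar_take[of "length ys"] by (auto simp: prefix_def)

lemma take_in_tree: "take j s \<in> tree"
  unfolding kohlenbach_tree_def strict_prefix_def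
  using prefix_not_bar prefix_order.trans[OF _ take_is_prefix[of j s]] by blast

lemma snoc_in_tree: "take j s @ [y] \<in> tree"
proof -
  have "\<not> kohlenbach_bar code basic (dtm (FD 0 s)) ys" if "strict_prefix ys (take j s @ [y])" for ys
  proof (rule prefix_not_bar)
    from that have "prefix ys (take j s)" by (auto simp: strict_prefix_def)
    then show "prefix ys s" using take_is_prefix by (rule prefix_order.trans)
  qed
  then show ?thesis by (simp add: kohlenbach_tree_def)
qed

lemma take_internal: "take j s \<in> internal_nodes tree"
  using snoc_in_tree take_in_tree by (auto simp: internal_nodes_def)

lemma snoc_leaf:
  assumes "j \<le> length s" "j < length s \<Longrightarrow> y \<noteq> s ! j"
  shows "take j s @ [y] \<in> leaves tree"
proof -
  have "strict_prefix (take j s @ [y]) ((take j s @ [y]) @ [z])" for z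
    by (simp add: strict_prefix_def)
  with bar_snoc[OF assms] have "(take j s @ [y]) @ [z] \<notin> tree" for z
    unfolding kohlenbach_tree_def by blast
  with snoc_in_tree show ?thesis by (auto simp: leaves_def)
qed

lemma tree_well_founded: "well_founded_tree tree"
  unfolding well_founded_tree_def
proof
  assume "\<exists>x::nat \<Rightarrow> nat. \<forall>n. map x [0..<n] \<in> tree"
  then obtain x :: "nat \<Rightarrow> nat" where x: "\<And>n. map x [0..<n] \<in> tree" by blast
  \<comment> \<open>The first deviation of the branch from the path, or the end of the path. The
    node after it is a leaf, so the branch leaves the tree one step later, at length
    \<open>Suc (Suc j)\<close>.\<close>
  define j where "j = (LEAST j. j < length s \<longrightarrow> x j \<noteq> s ! j)"
  have j: "j < length s \<Longrightarrow> x j \<noteq> s ! j"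
    using LeastI[of "\<lambda>j. j < length s \<longrightarrow> x j \<noteq> s ! j" "length s"] by (simp add: j_def)
  have "j \<le> length s" unfolding j_def by (rule Least_le) simp
  moreover have "x i = s ! i" if "i < j" for i
    using not_less_Least[of i "\<lambda>j. j < length s \<longrightarrow> x j \<noteq> s ! j"] that by (auto simp: j_def)
  ultimately have "map x [0..<j] = take j s" by (auto intro: nth_equalityI)
  then have "map x [0..<Suc (Suc j)] = take j s @ [x j] @ [x (Suc j)]" by simp
  with snoc_leaf[OF \<open>j \<le> length s\<close> j] x[of "Suc (Suc j)"] show False
    by (auto simp: leaves_def)
qed

text \<open>Downward induction on the path: at \<open>s\<close> the password alone releases
  \<open>c\<close>, and at a shorter prefix the child on the path already has the value
  \<open>c\<close>, which \<open>G\<close> checks and passes on.\<close>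

lemma eval_bar_recursion:
  assumes add: "is_add code add" and BR: "cl 0 BR"
    and leaf: "\<And>xs. xs \<in> leaves tree \<Longrightarrow>
      eval_eq (BR \<^bold>\<cdot> dtm (FD 0 s) \<^bold>\<cdot> dtm (GD s c) \<^bold>\<cdot> Num (code xs)) (Num (2 * code xs + 1))"
    and internal: "\<And>xs. xs \<in> internal_nodes tree \<Longrightarrow>
      eval_eq (BR \<^bold>\<cdot> dtm (FD 0 s) \<^bold>\<cdot> dtm (GD s c) \<^bold>\<cdot> Num (code xs))
        (dtm (GD s c) \<^bold>\<cdot>
          Lam NatT (BR \<^bold>\<cdot> dtm (FD 0 s) \<^bold>\<cdot> dtm (GD s c) \<^bold>\<cdot> (add \<^bold>\<cdot> Num (code xs) \<^bold>\<cdot> Var 0)))"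
    and "j \<le> length s"
  shows "evaluates (BR \<^bold>\<cdot> dtm (FD 0 s) \<^bold>\<cdot> dtm (GD s c) \<^bold>\<cdot> Num (code (take j s))) c"
proof -
  let ?F = "dtm (FD 0 s)" and ?G = "dtm (GD s c)"
  define W where "W xs = Lam NatT (BR \<^bold>\<cdot> ?F \<^bold>\<cdot> ?G \<^bold>\<cdot> (add \<^bold>\<cdot> Num (code xs) \<^bold>\<cdot> Var 0))" for xs
  have cl_add: "cl 0 add" using add closed_term_cl by (auto simp: is_add_def)
  have W: "evaluates (W xs \<^bold>\<cdot> Num y) u"
    if "evaluates (BR \<^bold>\<cdot> ?F \<^bold>\<cdot> ?G \<^bold>\<cdot> Num (code (xs @ [y]))) u" for xs y u
  proof -
    let ?t = "add \<^bold>\<cdot> Num (code xs) \<^bold>\<cdot> Num y"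
    have "W xs \<^bold>\<cdot> Num y \<leadsto> BR \<^bold>\<cdot> ?F \<^bold>\<cdot> ?G \<^bold>\<cdot> ?t"
      using step.beta[of NatT "BR \<^bold>\<cdot> ?F \<^bold>\<cdot> ?G \<^bold>\<cdot> (add \<^bold>\<cdot> Num (code xs) \<^bold>\<cdot> Var 0)" "Num y"]
      by (simp add: W_def subst_cl[OF BR] subst_cl[OF cl_add] subst_cl[OF cl_dtm])
    moreover have "evaluates (BR \<^bold>\<cdot> ?F \<^bold>\<cdot> ?G \<^bold>\<cdot> ?t) u"
    proof (rule rp_evaluates[OF _ that])
      show "rp ?t (code (xs @ [y])) (BR \<^bold>\<cdot> ?F \<^bold>\<cdot> ?G \<^bold>\<cdot> ?t) (BR \<^bold>\<cdot> ?F \<^bold>\<cdot> ?G \<^bold>\<cdot> Num (code (xs @ [y])))"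
        by (intro rp.App rp.here rp_refl)
      show "evaluates ?t (code (xs @ [y]))" using add by (simp add: is_add_def)
    qed (simp add: cl_add)
    ultimately show ?thesis using evaluates_expand by blast
  qed
  have pw: "evaluates (W (take i s) \<^bold>\<cdot> Num 0) (pw (take i s))" if "i \<le> length s" for i
  proof (rule W)
    have "take i s @ [0] \<in> leaves tree"
      using that nth_ge[of i] by (intro snoc_leaf) auto
    from leaf[OF this]
    show "evaluates (BR \<^bold>\<cdot> ?F \<^bold>\<cdot> ?G \<^bold>\<cdot> Num (code (take i s @ [0]))) (pw (take i s))"
      by (simp add: eval_eq_def pw_def)
  qed
  have node: "evaluates (BR \<^bold>\<cdot> ?F \<^bold>\<cdot> ?G \<^bold>\<cdot> Num (code (take i s))) c"
    if i: "i \<le> length s"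
      and run: "run (\<lambda>q. evaluates (W (take i s) \<^bold>\<cdot> Num q)) (GDr c [] s) (pw (take i s)) c" for i
  proof -
    have "evaluates (?G \<^bold>\<cdot> W (take i s)) c"
      unfolding evaluates_def using pw[OF i] run by (intro dtm_run) (auto simp: GD_def)
    with internal[OF take_internal] show ?thesis
      unfolding eval_eq_def W_def[symmetric] using evaluates_det by blast
  qed
  from \<open>j \<le> length s\<close> show ?thesis
  proof (induction rule: inc_induct)
    case base
    show ?case using run_GDr_end[of _ c "[]" s c] by (intro node) simp_all
  next
    case (step i)
    then have "evaluates (BR \<^bold>\<cdot> ?F \<^bold>\<cdot> ?G \<^bold>\<cdot> Num (code (take i s @ [s ! i]))) c"
      by (simp add: take_Suc_conv_app_nth)
    from W[OF this] show ?case
      using step.hyps(2) run_GDr_inner[of i s _ c "[]" c] by (intro node) auto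
  qed
qed

end

end

(* BR, F, G and add are closed, so they need no lifting under the abstraction. *)
theorem theorem30:
  fixes code :: "nat list \<Rightarrow> nat" and add basic :: tm
  assumes "prim_rec_coding code"
    and "is_add code add"
    and "is_basic code basic"
  shows "\<not> (\<exists>BR. closed_term T_min BR (pure_ty 2 \<^bold>\<rightarrow> pure_ty 2 \<^bold>\<rightarrow> pure_ty 1) \<and>
    (\<forall>F G. closed_term T0_str F (pure_ty 2) \<longrightarrow> closed_term T0_str G (pure_ty 2) \<longrightarrow>
       well_founded_tree (kohlenbach_tree code basic F) \<longrightarrow>
       (\<forall>xs \<in> kohlenbach_tree code basic F.
          (xs \<in> leaves (kohlenbach_tree code basic F) \<longrightarrow>
             eval_eq (BR \<^bold>\<cdot> F \<^bold>\<cdot> G \<^bold>\<cdot> Num (code xs)) (Num (2 * code xs + 1))) \<and>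
          (xs \<in> internal_nodes (kohlenbach_tree code basic F) \<longrightarrow>
             eval_eq (BR \<^bold>\<cdot> F \<^bold>\<cdot> G \<^bold>\<cdot> Num (code xs))
               (G \<^bold>\<cdot> Lam NatT (BR \<^bold>\<cdot> F \<^bold>\<cdot> G \<^bold>\<cdot> (add \<^bold>\<cdot> Num (code xs) \<^bold>\<cdot> Var 0)))))))"
proof
  assume "\<exists>BR. closed_term T_min BR (pure_ty 2 \<^bold>\<rightarrow> pure_ty 2 \<^bold>\<rightarrow> pure_ty 1) \<and>
    (\<forall>F G. closed_term T0_str F (pure_ty 2) \<longrightarrow> closed_term T0_str G (pure_ty 2) \<longrightarrow>
       well_founded_tree (kohlenbach_tree code basic F) \<longrightarrow>
       (\<forall>xs \<in> kohlenbach_tree code basic F.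
          (xs \<in> leaves (kohlenbach_tree code basic F) \<longrightarrow>
             eval_eq (BR \<^bold>\<cdot> F \<^bold>\<cdot> G \<^bold>\<cdot> Num (code xs)) (Num (2 * code xs + 1))) \<and>
          (xs \<in> internal_nodes (kohlenbach_tree code basic F) \<longrightarrow>
             eval_eq (BR \<^bold>\<cdot> F \<^bold>\<cdot> G \<^bold>\<cdot> Num (code xs))
               (G \<^bold>\<cdot> Lam NatT (BR \<^bold>\<cdot> F \<^bold>\<cdot> G \<^bold>\<cdot> (add \<^bold>\<cdot> Num (code xs) \<^bold>\<cdot> Var 0))))))"
  then obtain BR where BR: "closed_term T_min BR (pure_ty 2 \<^bold>\<rightarrow> pure_ty 2 \<^bold>\<rightarrow> pure_ty 1)"
    and eqs: "\<And>F G xs. closed_term T0_str F (pure_ty 2) \<Longrightarrow> closed_term T0_str G (pure_ty 2) \<Longrightarrow>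
       well_founded_tree (kohlenbach_tree code basic F) \<Longrightarrow> xs \<in> kohlenbach_tree code basic F \<Longrightarrow>
          (xs \<in> leaves (kohlenbach_tree code basic F) \<longrightarrow>
             eval_eq (BR \<^bold>\<cdot> F \<^bold>\<cdot> G \<^bold>\<cdot> Num (code xs)) (Num (2 * code xs + 1))) \<and>
          (xs \<in> internal_nodes (kohlenbach_tree code basic F) \<longrightarrow>
             eval_eq (BR \<^bold>\<cdot> F \<^bold>\<cdot> G \<^bold>\<cdot> Num (code xs))
               (G \<^bold>\<cdot> Lam NatT (BR \<^bold>\<cdot> F \<^bold>\<cdot> G \<^bold>\<cdot> (add \<^bold>\<cdot> Num (code xs) \<^bold>\<cdot> Var 0))))"
    by blast
  interpret coding code
    using assms(1) by unfold_locales (simp add: prim_rec_coding_def)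
  \<comment> \<open>One term for all adversaries: \<open>inst' s c\<close> turns it into bar
    recursion at the root for the path \<open>s\<close> and the secret \<open>c\<close>.\<close>
  define M where "M = BR \<^bold>\<cdot> Con CRecstr \<^bold>\<cdot> Con CByval \<^bold>\<cdot> Num (code [])"
  have conv_M: "conv s c M c" if s: "\<forall>x\<in>set s. 2 \<le> x" for s c
  proof -
    have "evaluates (BR \<^bold>\<cdot> dtm (FD 0 s) \<^bold>\<cdot> dtm (GD s c) \<^bold>\<cdot> Num (code (take 0 s))) c"
    proof (rule eval_bar_recursion[OF assms(3) s assms(2) closed_term_cl[OF BR]])
      note eqs = eqs[OF closed_term_dtm closed_term_dtm tree_well_founded[OF assms(3) s]]
      show "eval_eq (BR \<^bold>\<cdot> dtm (FD 0 s) \<^bold>\<cdot> dtm (GD s c) \<^bold>\<cdot> Num (code xs)) (Num (2 * code xs + 1))"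
        if "xs \<in> leaves (kohlenbach_tree code basic (dtm (FD 0 s)))" for xs
        using eqs[of xs "GD s c"] that by (auto simp: leaves_def)
      show "eval_eq (BR \<^bold>\<cdot> dtm (FD 0 s) \<^bold>\<cdot> dtm (GD s c) \<^bold>\<cdot> Num (code xs)) (dtm (GD s c) \<^bold>\<cdot>
          Lam NatT (BR \<^bold>\<cdot> dtm (FD 0 s) \<^bold>\<cdot> dtm (GD s c) \<^bold>\<cdot> (add \<^bold>\<cdot> Num (code xs) \<^bold>\<cdot> Var 0)))"
        if "xs \<in> internal_nodes (kohlenbach_tree code basic (dtm (FD 0 s)))" for xs
        using eqs[of xs "GD s c"] that by (auto simp: internal_nodes_def)
    qed simp
    moreover have "inst' s c BR = BR"
      using BR by (intro inst_T_min) (simp add: closed_term_def)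
    ultimately show ?thesis by (simp add: M_def)
  qed
  have "good M"
    using Red_closed_term[OF BR] Red_oracle[of CRecstr] Red_oracle[of CByval]
    by (simp add: M_def oracles_def good_Num)
  then have "claim M" using good_claim by blast
  then obtain v where "decided [] (\<lambda>s c. conv s c M v) (diverges M)"
    unfolding claim_def ext_def by fastforce
  then obtain t where t: "ext [] t"
    "(\<forall>s. ext t s \<longrightarrow> diverges M s) \<or> (\<exists>K. \<forall>s c. ext t s \<longrightarrow> c = 0 \<or> K < c \<longrightarrow> conv s c M v)"
    unfolding decided_def by blast
  then have tt: "ext t t" and "\<forall>x\<in>set t. 2 \<le> x"
    using ext_refl_right by (auto simp: ext_def)
  note conv_t = conv_M[OF this(2)]
  from t(2) show False
  proof (elim disjE exE)
    assume "\<forall>s. ext t s \<longrightarrow> diverges M s"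
    with tt conv_t show False by blast
  next
    fix K assume K: "\<forall>s c. ext t s \<longrightarrow> c = 0 \<or> K < c \<longrightarrow> conv s c M v"
    with tt have "conv t 0 M v" "conv t (Suc K) M v" by simp_all
    from evaluates_det[OF this(1) conv_t] evaluates_det[OF this(2) conv_t] show False by simp
  qed
qed

end
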